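(* Under the setting and standing assumptions of the context, let $(\bar x,\bar y)\in\mathbb R^n\times\mathbb R^m$ and suppose that the sequences $\{(x^k,y^k,z^k,s^k)\}\subset\mathbb R^{n+m+q+q}$, $\{\varepsilon^k\}\subset\mathbb R^{n+m+q+q}$ and $\{(\rho_1^k,\rho_2^k)\}\subset(0,\infty)^2$ satisfy $$(x^k,y^k)\to(\bar x,\bar y),\quad\varepsilon^k\to0,\quad(x^k,y^k)\in\Omega,\ (z^k,s^k)\in\mathcal C\ \ \forall k,\quad\mathcal G_\gamma(x^k,y^k,z^k)\to0,\quad g(x^k,y^k)+s^k\to0,$$ $$\varepsilon^k\in\nabla F(x^k,y^k)+\rho_1^k\nabla\mathcal G_\gamma(x^k,y^k,z^k)+\rho_2^k\nabla\big(\|g(x^k,y^k)+s^k\|^2\big)+\mathcal N_\Omega(x^k,y^k)\times\mathcal N_{\mathcal C}(z^k,s^k)\quad\forall k,$$ where all gradients are regarded as vectors in the $(x,y,z,s)$-space with zero entries for absent variables and $\nabla(\|g(x,y)+s\|^2)$ is the gradient with respect to $(x,y,s)$. Assume that MFCQ holds at $\bar y$ for the system $\{y\mid g(\bar x,y)\le0\}$ and that MFCQ holds at $(\bar x,\bar y)$ for the system $\{(x,y)\mid G(x,y)\le0\}$. Let $\bar z\in\mathbb R^q_+$ be any accumulation point of $\{z^k\}$ and put $\bar w:=(\bar x,\bar y,\bar z)$. Then: 1. If both $\{\rho_1^k\}$ and $\{\rho_2^k\}$ are bounded, then $\bar w$ is S-stationary for the MPCC. 2. If $\rho_1^k\to+\infty$,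 $\rho_2^k\to+\infty$ and $\rho_2^k/\rho_1^k\to+\infty$, and, in addition, MPCC-MFCQ holds at $\bar w$ for the MPCC, then $\bar w$ is M-stationary for the MPCC.
   Context: Setting. $F,f:\mathbb R^n\times\mathbb R^m\to\mathbb R$, $G=(G_1,\dots,G_p):\mathbb R^n\times\mathbb R^m\to\mathbb R^p$, $g=(g_1,\dots,g_q):\mathbb R^n\times\mathbb R^m\to\mathbb R^q$; $\Omega:=\{(x,y)\mid G(x,y)\le0\}$ and $X:=\{x\in\mathbb R^n\mid\exists y\in\mathbb R^m:(x,y)\in\Omega\}$. $\mathcal C:=\{(z,s)\in\mathbb R^q_+\times\mathbb R^q_+\mid z_is_i=0,\ i=1,\dots,q\}$. Vector inequalities are componentwise. Standing assumptions. $F$ is continuously differentiable on an open set containing $\Omega$; each $G_i$ is continuously differentiable and convex on an open set containing $\Omega$. For every $x\in X$, $f(x,\cdot)$ and $g_i(x,\cdot)$ ($i=1,\dots,q$) are convex on $\mathbb R^m$; $f$ and all $g_i$ are twice continuously differentiable on an open set containing $X\times\mathbb R^m$. Regularized gap function. $\mathcal L(x,y,z):=f(x,y)+z^\top g(x,y)$. Fix $\gamma=(\gamma_1,\gamma_2)$ with $\gamma_1,\gamma_2>0$. For $(x,y,z)\in\Omega\times\mathbb R^q_+$, $$\mathcal G_\gamma(x,y,z):=\max_{\theta\in\mathbb R^m,\ \lambda\in\mathbb R^q_+}\Big\{\mathcal L(x,y,\lambda)-\tfrac1{2\gamma_2}\|\lambda-z\|^2-\mathcal L(x,\theta,z)-\tfrac1{2\gamma_1}\|\theta-y\|^2\Big\}.$$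 Put $\theta^*=\theta^*(x,y,z):=\operatorname{argmin}_{\theta\in\mathbb R^m}\{f(x,\theta)+z^\top g(x,\theta)+\tfrac1{2\gamma_1}\|\theta-y\|^2\}$ (unique) and $\lambda^*=\lambda^*(x,y,z):=\operatorname{Proj}_{\mathbb R^q_+}(z+\gamma_2g(x,y))$. $\mathcal G_\gamma$ is continuously differentiable on $\Omega\times\mathbb R^q_+$ with gradient (components in $x,y,z$) $$\nabla\mathcal G_\gamma(x,y,z)=\begin{pmatrix}\nabla_xf(x,y)+\nabla_xg(x,y)^\top\lambda^*-\nabla_xf(x,\theta^* )-\nabla_xg(x,\theta^* )^\top z\\ \nabla_yf(x,y)+\nabla_yg(x,y)^\top\lambda^*-(y-\theta^* )/\gamma_1\\ -(z-\lambda^* )/\gamma_2-g(x,\theta^* )\end{pmatrix}.$$ Notation. $\nabla g,\nabla G$ are Jacobians; $\nabla_yg_i\in\mathbb R^m$ is the gradient in $y$; $\nabla_{x,y}\mathcal L\in\mathbb R^{n+m}$ is the gradient in $(x,y)$ and $\nabla_y\nabla_{x,y}\mathcal L$ is its $(n+m)\times m$ Jacobian in $y$. $\mathcal N_D$ is the limiting (Mordukhovich) normal cone to a closed set $D$ (the usual normal cone if $D$ is convex). MFCQ. For a system $\{w\mid h(w)=0,\ c(w)\le0\}$ with continuously differentiable $h,c$, MFCQ holds at a feasible point $\bar w$ if $\sum_j\mu^h_j\nabla h_j(\bar w)+\sum_{i:c_i(\bar w)=0}\mu^c_i\nabla c_i(\bar w)=0$ with $\mu^h_j\in\mathbb R$,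 $\mu^c_i\ge0$ implies that all these multipliers vanish. The MPCC is $$\min_{x,y,z}\ F(x,y)\quad\text{s.t. } G(x,y)\le0,\ \nabla_y\mathcal L(x,y,z)=0,\ 0\le z\perp-g(x,y)\ge0.$$ For a feasible $\bar w=(\bar x,\bar y,\bar z)$ let $\mathcal I_{+0}=\{i\mid\bar z_i>0,g_i(\bar x,\bar y)=0\}$, $\mathcal I_{0+}=\{i\mid\bar z_i=0,g_i(\bar x,\bar y)<0\}$, $\mathcal I_{00}=\{i\mid\bar z_i=0,g_i(\bar x,\bar y)=0\}$. MPCC-MFCQ holds at $\bar w$ if MFCQ holds at $\bar w$ for the system in $(x,y,z)$: $G(x,y)\le0$; $\nabla_y\mathcal L(x,y,z)=0$; $-g_i(x,y)=0$ ($i\in\mathcal I_{+0}\cup\mathcal I_{00}$); $z_i=0$ ($i\in\mathcal I_{0+}\cup\mathcal I_{00}$); $-g_i(x,y)\ge0$ ($i\in\mathcal I_{0+}$); $z_i\ge0$ ($i\in\mathcal I_{+0}$). Stationarity. A feasible $\bar w$ of the MPCC is S-stationary (resp. M-stationary) if there exist $\mu\in\mathbb R^p_+$, $\omega\in\mathbb R^m$, $\eta\in\mathbb R^q$ with $$0=\nabla F(\bar x,\bar y)+\nabla G(\bar x,\bar y)^\top\mu+\nabla_y\nabla_{x,y}\mathcal L(\bar x,\bar y,\bar z)\,\omega+\nabla g(\bar x,\bar y)^\top\eta,$$ $\mu_jG_j(\bar x,\bar y)=0$ for all $j$, $\eta_i=0$ for $i\in\mathcal I_{0+}$, $\nabla_yg_i(\bar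 x,\bar y)^\top\omega=0$ for $i\in\mathcal I_{+0}$, and, for every $i\in\mathcal I_{00}$: $\eta_i\ge0$ and $\nabla_yg_i(\bar x,\bar y)^\top\omega\ge0$ (S-stationary); resp. either ($\eta_i>0$ and $\nabla_yg_i(\bar x,\bar y)^\top\omega>0$) or $\eta_i\,\nabla_yg_i(\bar x,\bar y)^\top\omega=0$ (M-stationary). *)

theory Defs
  imports "HOL-Analysis.Analysis"
begin

definition gradient :: "('a::real_inner \<Rightarrow> real) \<Rightarrow> 'a \<Rightarrow> 'a" where
  "gradient h w = (THE d. GDERIV h w :> d)"

text \<open>The product of the transposed Jacobian of \<open>h\<close> at \<open>w\<close> with the vector \<open>c\<close>;
  the rows of the Jacobian are the gradients of the components of \<open>h\<close>.\<close>

definition jacobian_T :: "('a::real_inner \<Rightarrow> real^'k) \<Rightarrow> 'a \<Rightarrow> real^'k \<Rightarrow> 'a" where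
  "jacobian_T h w c = (\<Sum>j\<in>UNIV. c $ j *\<^sub>R gradient (\<lambda>u. h u $ j) w)"

text \<open>On a Euclidean space, continuity of all directional derivatives is the same as continuity
  of the derivative in the operator norm.\<close>

definition C1_on :: "'a::euclidean_space set \<Rightarrow> ('a \<Rightarrow> 'b::real_normed_vector) \<Rightarrow> bool" where
  "C1_on U h \<longleftrightarrow> (\<forall>w\<in>U. h differentiable (at w)) \<and>
     (\<forall>v. continuous_on U (\<lambda>w. frechet_derivative h (at w) v))"

definition C2_on :: "'a::euclidean_space set \<Rightarrow> ('a \<Rightarrow> real) \<Rightarrow> bool" where
  "C2_on U h \<longleftrightarrow> C1_on U h \<and> C1_on U (gradient h)"

text \<open>Regular (Frechet) normals: \<open>limsup (v \<bullet> (u - w) / norm (u - w)) \<le> 0\<close> as \<open>u\<close> tends to \<open>w\<close>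
  within \<open>D - {w}\<close>.\<close>

definition regular_normal_cone :: "'a::euclidean_space set \<Rightarrow> 'a \<Rightarrow> 'a set" where
  "regular_normal_cone D w =
     {v. \<forall>e>0. \<exists>d>0. \<forall>u\<in>D. dist u w < d \<longrightarrow> v \<bullet> (u - w) \<le> e * norm (u - w)}"

definition limiting_normal_cone :: "'a::euclidean_space set \<Rightarrow> 'a \<Rightarrow> 'a set" where
  "limiting_normal_cone D w =
     {v. w \<in> D \<and> (\<exists>W V. (\<forall>k::nat. W k \<in> D \<and> V k \<in> regular_normal_cone D (W k)) \<and>
                        W \<longlonglongrightarrow> w \<and> V \<longlonglongrightarrow> v)}"

lemma regular_normal_cone_convex:
  assumes "convex D" "w \<in> D" "v \<in> regular_normal_cone D w" "u \<in> D"
  shows "v \<bullet> (u - w) \<le> 0"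
proof (cases "u = w")
  case False
  then have pos: "norm (u - w) > 0" by simp
  have le: "v \<bullet> (u - w) \<le> e * norm (u - w)" if "e > 0" for e
  proof -
    obtain d where d: "d > 0" "\<forall>u\<in>D. dist u w < d \<longrightarrow> v \<bullet> (u - w) \<le> e * norm (u - w)"
      using assms(3) \<open>e > 0\<close> unfolding regular_normal_cone_def by blast
    define t where "t = min 1 (d / (2 * norm (u - w)))"
    have t: "0 < t" "t \<le> 1" using d(1) pos by (auto simp: t_def)
    define u' where "u' = (1 - t) *\<^sub>R w + t *\<^sub>R u"
    have u': "u' - w = t *\<^sub>R (u - w)" by (simp add: u'_def algebra_simps)
    have "u' \<in> D" using assms t unfolding u'_def by (intro convexD) auto
    moreover have "dist u' w < d"
    proof -
      have "t * norm (u - w) \<le> d / (2 * norm (u - w)) * norm (u - w)"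
        by (intro mult_right_mono) (auto simp: t_def)
      also have "\<dots> < d" using d(1) pos by simp
      finally show ?thesis using t by (simp add: dist_norm u')
    qed
    ultimately have "v \<bullet> (u' - w) \<le> e * norm (u' - w)" using d(2) by blast
    then have "t * (v \<bullet> (u - w)) \<le> t * (e * norm (u - w))"
      using t by (simp add: u' mult_ac)
    then show ?thesis using t(1) mult_le_cancel_left_pos by blast
  qed
  show ?thesis
  proof (rule field_le_epsilon)
    fix e :: real assume "e > 0"
    then show "v \<bullet> (u - w) \<le> 0 + e" using le[of "e / norm (u - w)"] pos by simp
  qed
qed simp

lemma limiting_normal_cone_convex:
  assumes "convex D" "w \<in> D"
  shows "limiting_normal_cone D w = {v. \<forall>u\<in>D. v \<bullet> (u - w) \<le> 0}"
proof (intro set_eqI iffI)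
  fix v assume "v \<in> limiting_normal_cone D w"
  then obtain W V where WV: "\<And>k::nat. W k \<in> D" "\<And>k. V k \<in> regular_normal_cone D (W k)"
    "W \<longlonglongrightarrow> w" "V \<longlonglongrightarrow> v"
    unfolding limiting_normal_cone_def by blast
  have "v \<bullet> (u - w) \<le> 0" if "u \<in> D" for u
  proof (rule LIMSEQ_le_const2)
    show "(\<lambda>k. V k \<bullet> (u - W k)) \<longlonglongrightarrow> v \<bullet> (u - w)"
      by (intro tendsto_intros WV)
    show "\<exists>N. \<forall>n\<ge>N. V n \<bullet> (u - W n) \<le> 0"
      using regular_normal_cone_convex[OF assms(1) WV(1) WV(2) that] by blast
  qed
  then show "v \<in> {v. \<forall>u\<in>D. v \<bullet> (u - w) \<le> 0}" by blast
next
  fix v assume v: "v \<in> {v. \<forall>u\<in>D. v \<bullet> (u - w) \<le> 0}"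
  have "v \<bullet> (u - w) \<le> e * norm (u - w)" if "u \<in> D" "e > 0" for u e
  proof -
    have "v \<bullet> (u - w) \<le> 0" using v that by blast
    also have "0 \<le> e * norm (u - w)" using that by simp
    finally show ?thesis .
  qed
  then have "v \<in> regular_normal_cone D w"
    unfolding regular_normal_cone_def by (auto intro: exI[of _ 1])
  then have "(\<forall>k::nat. w \<in> D \<and> v \<in> regular_normal_cone D w) \<and> (\<lambda>_::nat. w) \<longlonglongrightarrow> w \<and> (\<lambda>_::nat. v) \<longlonglongrightarrow> v"
    using assms(2) by simp
  then show "v \<in> limiting_normal_cone D w"
    unfolding limiting_normal_cone_def using assms(2)
    by (intro CollectI conjI[OF assms(2)])
      (rule exI[of _ "\<lambda>_. w"], rule exI[of _ "\<lambda>_. v"])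
qed

text \<open>The system is \<open>h i w = 0\<close> for \<open>i \<in> I\<close> and \<open>c j w \<le> 0\<close> for \<open>j \<in> J\<close>, with finite \<open>I\<close> and \<open>J\<close>.
  The condition is only defined at feasible points, so feasibility of \<open>w\<close> is part of it.\<close>

definition MFCQ ::
  "'i set \<Rightarrow> ('i \<Rightarrow> 'a::euclidean_space \<Rightarrow> real) \<Rightarrow> 'j set \<Rightarrow> ('j \<Rightarrow> 'a \<Rightarrow> real) \<Rightarrow> 'a \<Rightarrow> bool" where
  "MFCQ I h J c w \<longleftrightarrow>
     (\<forall>i\<in>I. h i w = 0) \<and> (\<forall>j\<in>J. c j w \<le> 0) \<and>
     (\<forall>\<mu> \<nu>. (\<forall>j\<in>{j\<in>J. c j w = 0}. 0 \<le> \<nu> j) \<and>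
            (\<Sum>i\<in>I. \<mu> i *\<^sub>R gradient (h i) w) +
              (\<Sum>j\<in>{j\<in>J. c j w = 0}. \<nu> j *\<^sub>R gradient (c j) w) = 0 \<longrightarrow>
            (\<forall>i\<in>I. \<mu> i = 0) \<and> (\<forall>j\<in>{j\<in>J. c j w = 0}. \<nu> j = 0))"

definition MFCQ_ineq :: "('a::euclidean_space \<Rightarrow> real^'k) \<Rightarrow> 'a \<Rightarrow> bool" where
  "MFCQ_ineq c w \<longleftrightarrow> MFCQ ({}::unit set) (\<lambda>_ _. 0) UNIV (\<lambda>j u. c u $ j) w"

text \<open>The order on \<open>real^'k\<close> is componentwise. Vectors of the \<open>(x,y,z)\<close>-space are represented as
  \<open>((x,y),z)\<close> and vectors of the \<open>(x,y,z,s)\<close>-space as \<open>((x,y),(z,s))\<close>.\<close>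

definition Omega :: "((real^'n) \<times> (real^'m) \<Rightarrow> real^'p) \<Rightarrow> ((real^'n) \<times> (real^'m)) set" where
  "Omega G = {(x, y). G (x, y) \<le> 0}"

definition Xset :: "((real^'n) \<times> (real^'m) \<Rightarrow> real^'p) \<Rightarrow> (real^'n) set" where
  "Xset G = {x. \<exists>y. (x, y) \<in> Omega G}"

definition Ccompl :: "((real^'q) \<times> (real^'q)) set" where
  "Ccompl = {(z, s). 0 \<le> z \<and> 0 \<le> s \<and> (\<forall>i. z $ i * s $ i = 0)}"

definition Lag ::
  "((real^'n) \<times> (real^'m) \<Rightarrow> real) \<Rightarrow> ((real^'n) \<times> (real^'m) \<Rightarrow> real^'q) \<Rightarrow>
   real^'n \<Rightarrow> real^'m \<Rightarrow> real^'q \<Rightarrow> real" where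
  "Lag f g x y z = f (x, y) + z \<bullet> g (x, y)"

text \<open>For \<open>x \<in> Xset G\<close>, \<open>z \<ge> 0\<close> and positive \<open>\<gamma>1\<close>, \<open>\<gamma>2\<close> the supremum is a maximum: the objective
  splits into a strongly concave function of \<open>\<theta>\<close> and one of \<open>l\<close>.\<close>

definition gap ::
  "((real^'n) \<times> (real^'m) \<Rightarrow> real) \<Rightarrow> ((real^'n) \<times> (real^'m) \<Rightarrow> real^'q) \<Rightarrow> real \<Rightarrow> real \<Rightarrow>
   real^'n \<Rightarrow> real^'m \<Rightarrow> real^'q \<Rightarrow> real" where
  "gap f g \<gamma>1 \<gamma>2 x y z =
     (SUP (\<theta>, l) \<in> UNIV \<times> {l. 0 \<le> l}.
        Lag f g x y l - 1 / (2 * \<gamma>2) * (norm (l - z))\<^sup>2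
        - Lag f g x \<theta> z - 1 / (2 * \<gamma>1) * (norm (\<theta> - y))\<^sup>2)"

definition theta_star ::
  "((real^'n) \<times> (real^'m) \<Rightarrow> real) \<Rightarrow> ((real^'n) \<times> (real^'m) \<Rightarrow> real^'q) \<Rightarrow> real \<Rightarrow>
   real^'n \<Rightarrow> real^'m \<Rightarrow> real^'q \<Rightarrow> real^'m" where
  "theta_star f g \<gamma>1 x y z =
     (ARG_MIN (\<lambda>\<theta>. f (x, \<theta>) + z \<bullet> g (x, \<theta>) + 1 / (2 * \<gamma>1) * (norm (\<theta> - y))\<^sup>2) \<theta>. True)"

definition lambda_star ::
  "((real^'n) \<times> (real^'m) \<Rightarrow> real^'q) \<Rightarrow> real \<Rightarrow> real^'n \<Rightarrow> real^'m \<Rightarrow> real^'q \<Rightarrow> real^'q" where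
  "lambda_star g \<gamma>2 x y z = closest_point {l. 0 \<le> l} (z + \<gamma>2 *\<^sub>R g (x, y))"

text \<open>The gradient of \<^term>\<open>gap f g \<gamma>1 \<gamma>2\<close> at points of \<open>Omega G \<times> {z. 0 \<le> z}\<close>. That set is not open, and
  outside of it the supremum may be infinite, so \<^const>\<open>gradient\<close> is not applicable at its boundary;
  the gradient is given by Danskin's theorem: differentiate the objective with respect to
  \<open>(x,y,z)\<close> and insert the unique maximizer \<open>(theta_star, lambda_star)\<close>.\<close>

definition gap_gradient ::
  "((real^'n) \<times> (real^'m) \<Rightarrow> real) \<Rightarrow> ((real^'n) \<times> (real^'m) \<Rightarrow> real^'q) \<Rightarrow> real \<Rightarrow> real \<Rightarrow>
   real^'n \<Rightarrow> real^'m \<Rightarrow> real^'q \<Rightarrow> ((real^'n) \<times> (real^'m)) \<times> (real^'q)" where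
  "gap_gradient f g \<gamma>1 \<gamma>2 x y z =
     (let \<theta> = theta_star f g \<gamma>1 x y z; l = lambda_star g \<gamma>2 x y z in
       ((gradient (\<lambda>x. f (x, y)) x + jacobian_T (\<lambda>x. g (x, y)) x l
           - gradient (\<lambda>x. f (x, \<theta>)) x - jacobian_T (\<lambda>x. g (x, \<theta>)) x z,
         gradient (\<lambda>y. f (x, y)) y + jacobian_T (\<lambda>y. g (x, y)) y l - (1 / \<gamma>1) *\<^sub>R (y - \<theta>)),
        - ((1 / \<gamma>2) *\<^sub>R (z - l)) - g (x, \<theta>)))"

definition MPCC_feasible ::
  "((real^'n) \<times> (real^'m) \<Rightarrow> real) \<Rightarrow> ((real^'n) \<times> (real^'m) \<Rightarrow> real^'p) \<Rightarrow>
   ((real^'n) \<times> (real^'m) \<Rightarrow> real^'q) \<Rightarrow> real^'n \<Rightarrow> real^'m \<Rightarrow> real^'q \<Rightarrow> bool" where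
  "MPCC_feasible f G g x y z \<longleftrightarrow>
     G (x, y) \<le> 0 \<and> gradient (\<lambda>y. Lag f g x y z) y = 0 \<and>
     0 \<le> z \<and> - g (x, y) \<ge> 0 \<and> orthogonal z (- g (x, y))"

definition I_plus_zero ::
  "((real^'n) \<times> (real^'m) \<Rightarrow> real^'q) \<Rightarrow> real^'n \<Rightarrow> real^'m \<Rightarrow> real^'q \<Rightarrow> 'q set" where
  "I_plus_zero g x y z = {i. z $ i > 0 \<and> g (x, y) $ i = 0}"

definition I_zero_plus ::
  "((real^'n) \<times> (real^'m) \<Rightarrow> real^'q) \<Rightarrow> real^'n \<Rightarrow> real^'m \<Rightarrow> real^'q \<Rightarrow> 'q set" where
  "I_zero_plus g x y z = {i. z $ i = 0 \<and> g (x, y) $ i < 0}"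

definition I_zero_zero ::
  "((real^'n) \<times> (real^'m) \<Rightarrow> real^'q) \<Rightarrow> real^'n \<Rightarrow> real^'m \<Rightarrow> real^'q \<Rightarrow> 'q set" where
  "I_zero_zero g x y z = {i. z $ i = 0 \<and> g (x, y) $ i = 0}"

text \<open>The constraints of the system are indexed by disjoint sums; the inequalities
  \<open>- g\<^sub>i \<ge> 0\<close> and \<open>z\<^sub>i \<ge> 0\<close> are brought into the form \<open>c \<le> 0\<close>.\<close>

definition MPCC_MFCQ ::
  "((real^'n) \<times> (real^'m) \<Rightarrow> real) \<Rightarrow> ((real^'n) \<times> (real^'m) \<Rightarrow> real^'p) \<Rightarrow>
   ((real^'n) \<times> (real^'m) \<Rightarrow> real^'q) \<Rightarrow> real^'n \<Rightarrow> real^'m \<Rightarrow> real^'q \<Rightarrow> bool" where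
  "MPCC_MFCQ f G g x y z \<longleftrightarrow>
     MFCQ
       ((UNIV :: 'm set) <+>
         ((I_plus_zero g x y z \<union> I_zero_zero g x y z) <+> (I_zero_plus g x y z \<union> I_zero_zero g x y z)))
       (case_sum (\<lambda>j ((x, y), z). gradient (\<lambda>y. Lag f g x y z) y $ j)
         (case_sum (\<lambda>i ((x, y), z). - g (x, y) $ i) (\<lambda>i ((x, y), z). z $ i)))
       ((UNIV :: 'p set) <+> (I_zero_plus g x y z <+> I_plus_zero g x y z))
       (case_sum (\<lambda>j ((x, y), z). G (x, y) $ j)
         (case_sum (\<lambda>i ((x, y), z). g (x, y) $ i) (\<lambda>i ((x, y), z). - z $ i)))
       ((x, y), z)"

text \<open>The part shared by S- and M-stationarity; the product of the \<open>(n+m) \<times> m\<close> Jacobian in \<open>y\<close> of the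
  gradient of the Lagrangian in \<open>(x,y)\<close> with \<open>\<omega>\<close> is the Frechet derivative applied to \<open>\<omega>\<close>.\<close>

definition stationarity_multipliers ::
  "((real^'n) \<times> (real^'m) \<Rightarrow> real) \<Rightarrow> ((real^'n) \<times> (real^'m) \<Rightarrow> real) \<Rightarrow>
   ((real^'n) \<times> (real^'m) \<Rightarrow> real^'p) \<Rightarrow> ((real^'n) \<times> (real^'m) \<Rightarrow> real^'q) \<Rightarrow>
   real^'n \<Rightarrow> real^'m \<Rightarrow> real^'q \<Rightarrow> real^'p \<Rightarrow> real^'m \<Rightarrow> real^'q \<Rightarrow> bool" where
  "stationarity_multipliers F f G g x y z \<mu> \<omega> \<eta> \<longleftrightarrow>
     0 \<le> \<mu> \<and>
     0 = gradient F (x, y) + jacobian_T G (x, y) \<mu>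
         + frechet_derivative (\<lambda>y. gradient (\<lambda>(x, y). Lag f g x y z) (x, y)) (at y) \<omega>
         + jacobian_T g (x, y) \<eta> \<and>
     (\<forall>j. \<mu> $ j * G (x, y) $ j = 0) \<and>
     (\<forall>i\<in>I_zero_plus g x y z. \<eta> $ i = 0) \<and>
     (\<forall>i\<in>I_plus_zero g x y z. gradient (\<lambda>y. g (x, y) $ i) y \<bullet> \<omega> = 0)"

definition S_stationary ::
  "((real^'n) \<times> (real^'m) \<Rightarrow> real) \<Rightarrow> ((real^'n) \<times> (real^'m) \<Rightarrow> real) \<Rightarrow>
   ((real^'n) \<times> (real^'m) \<Rightarrow> real^'p) \<Rightarrow> ((real^'n) \<times> (real^'m) \<Rightarrow> real^'q) \<Rightarrow>
   real^'n \<Rightarrow> real^'m \<Rightarrow> real^'q \<Rightarrow> bool" where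
  "S_stationary F f G g x y z \<longleftrightarrow>
     MPCC_feasible f G g x y z \<and>
     (\<exists>\<mu> \<omega> \<eta>. stationarity_multipliers F f G g x y z \<mu> \<omega> \<eta> \<and>
        (\<forall>i\<in>I_zero_zero g x y z. \<eta> $ i \<ge> 0 \<and> gradient (\<lambda>y. g (x, y) $ i) y \<bullet> \<omega> \<ge> 0))"

definition M_stationary ::
  "((real^'n) \<times> (real^'m) \<Rightarrow> real) \<Rightarrow> ((real^'n) \<times> (real^'m) \<Rightarrow> real) \<Rightarrow>
   ((real^'n) \<times> (real^'m) \<Rightarrow> real^'p) \<Rightarrow> ((real^'n) \<times> (real^'m) \<Rightarrow> real^'q) \<Rightarrow>
   real^'n \<Rightarrow> real^'m \<Rightarrow> real^'q \<Rightarrow> bool" where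
  "M_stationary F f G g x y z \<longleftrightarrow>
     MPCC_feasible f G g x y z \<and>
     (\<exists>\<mu> \<omega> \<eta>. stationarity_multipliers F f G g x y z \<mu> \<omega> \<eta> \<and>
        (\<forall>i\<in>I_zero_zero g x y z.
           \<eta> $ i > 0 \<and> gradient (\<lambda>y. g (x, y) $ i) y \<bullet> \<omega> > 0 \<or>
           \<eta> $ i * (gradient (\<lambda>y. g (x, y) $ i) y \<bullet> \<omega>) = 0))"

end

theory Submission
  imports Defs
begin

text \<open>
  The regularized gap dominates \<open>|\<lambda>\<^sup>* - z|\<^sup>2 / (2\<gamma>\<^sub>2) + |\<theta>\<^sup>* - y|\<^sup>2 / (2\<gamma>\<^sub>1)\<close>, so \<open>\<theta>\<^sup>*\<close> tends to the
  limit of \<open>y\<close> and \<open>\<lambda>\<^sup>* - z\<close> to \<open>0\<close>; hence the limit point is feasible and the \<open>(x, y)\<close>-gradient of the gap vanishes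
  there. If the penalty parameters are bounded, the penalty terms disappear in the limit and
  S-stationarity holds with \<open>\<omega> = 0\<close> and \<open>\<eta> = 0\<close>. Otherwise the multipliers are the limits of
  \<open>\<omega> = \<rho>\<^sub>1 (y - \<theta>\<^sup>*)\<close> and \<open>\<eta> = \<rho>\<^sub>1 (\<lambda>\<^sup>* - z) + 2\<rho>\<^sub>2 (g + s)\<close>. The normal cone of the complementarity set
  passes its sign structure on to \<open>\<eta>\<^sub>i\<close> and \<open>\<nabla>\<^sub>yg\<^sub>i \<bullet> \<omega>\<close>, up to errors of order \<open>\<rho>\<^sub>1 / \<rho>\<^sub>2\<close>, and MPCC-MFCQ
  rules out that the multipliers are unbounded.
\<close>

section \<open>Gradients and second derivatives\<close>

text \<open>No rate is known at which \<open>y - \<theta>\<close> vanishes, and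
  \<open>\<rho>1\<close> may blow up. The product of \<open>\<rho>1\<close> with a difference of
  gradients at \<open>y\<close> and \<open>\<theta>\<close> has two moving arguments, so
  differentiability at the limit point is not enough; strict differentiability, which C1 functions
  have, gives the Hessian limit. The \<open>z\<close>-row contains \<open>\<rho>1\<close> times
  \<open>g\<close>, which no multiplier controls directly. But it equals
  \<open>\<rho>1 / (2 * \<rho>2)\<close> times a quantity that is either a summand of
  \<open>\<eta>\<close> hidden by no cancellation, or is bounded by the residual. Hence the demand
  on the ratio of the penalties. At a biactive index, nearby points may lie on a single branch of
  the complementarity set. Limits of normals therefore keep only a sign alternative, which is the
  M-type condition. Symmetry of the Hessian enters because MPCC-MFCQ is stated with gradients of the
  components of the \<open>y\<close>-gradient of the Lagrangian, whereas the limit process yields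
  the Hessian applied to \<open>(0, \<omega>)\<close>.\<close>

lemma gradient_eqI: "GDERIV h w :> d \<Longrightarrow> gradient h w = d"
proof -
  assume d: "GDERIV h w :> d"
  have "d' = d" if "GDERIV h w :> d'" for d'
  proof -
    have "(\<lambda>v. v \<bullet> d') = (\<lambda>v. v \<bullet> d)"
      using has_derivative_unique d that unfolding gderiv_def by blast
    then show ?thesis
      by (metis vector_eq_ldot)
  qed
  then show ?thesis
    unfolding gradient_def using d by blast
qed

lemma GDERIV_gradient:
  fixes h :: "'a::euclidean_space \<Rightarrow> real"
  assumes "h differentiable (at w)"
  shows "GDERIV h w :> gradient h w"
proof -
  let ?A = "frechet_derivative h (at w)"
  have A: "(h has_derivative ?A) (at w)"
    using assms frechet_derivative_works by blast
  then have lin: "linear ?A"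
    using has_derivative_linear by blast
  define d where "d = (\<Sum>b\<in>Basis. ?A b *\<^sub>R b)"
  have "?A v = v \<bullet> d" for v
  proof -
    have "?A v = ?A (\<Sum>b\<in>Basis. (v \<bullet> b) *\<^sub>R b)"
      by (simp add: euclidean_representation)
    also have "\<dots> = (\<Sum>b\<in>Basis. (v \<bullet> b) * ?A b)"
      by (simp add: linear_sum[OF lin] linear_cmul[OF lin])
    also have "\<dots> = v \<bullet> d"
      by (simp add: d_def inner_sum_right mult.commute)
    finally show ?thesis .
  qed
  then have "?A = (\<lambda>v. v \<bullet> d)"
    by blast
  then have "GDERIV h w :> d"
    using A by (simp add: gderiv_def)
  then show ?thesis
    using gradient_eqI by metis
qed

lemma frechet_derivative_gradient:
  fixes h :: "'a::euclidean_space \<Rightarrow> real"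
  assumes "h differentiable (at w)"
  shows "frechet_derivative h (at w) v = v \<bullet> gradient h w"
  using frechet_derivative_at[OF GDERIV_gradient[OF assms, unfolded gderiv_def]] by metis

lemma GDERIV_fst:
  assumes "GDERIV h (x, y) :> d"
  shows "GDERIV (\<lambda>x. h (x, y)) x :> fst d"
proof -
  have "((\<lambda>x. (x, y)) has_derivative (\<lambda>v. (v, 0))) (at x)"
    by (auto intro!: derivative_eq_intros)
  from has_derivative_compose[OF this, of h "\<lambda>v. v \<bullet> d"] assms show ?thesis
    by (simp add: gderiv_def inner_prod_def)
qed

lemma GDERIV_snd:
  assumes "GDERIV h (x, y) :> d"
  shows "GDERIV (\<lambda>y. h (x, y)) y :> snd d"
proof -
  have "((\<lambda>y. (x, y)) has_derivative (\<lambda>v. (0, v))) (at y)"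
    by (auto intro!: derivative_eq_intros)
  from has_derivative_compose[OF this, of h "\<lambda>v. v \<bullet> d"] assms show ?thesis
    by (simp add: gderiv_def inner_prod_def)
qed

lemma GDERIV_sum_scaleR:
  assumes "\<And>i. i \<in> I \<Longrightarrow> GDERIV (h i) w :> d i"
  shows "GDERIV (\<lambda>u. \<Sum>i\<in>I. c i * h i u) w :> (\<Sum>i\<in>I. c i *\<^sub>R d i)"
  using assms unfolding gderiv_def inner_sum_right inner_scaleR_right
  by (intro has_derivative_sum has_derivative_mult_right) auto

lemma C1_on_GDERIV:
  fixes h :: "'a::euclidean_space \<Rightarrow> real"
  shows "C1_on U h \<Longrightarrow> w \<in> U \<Longrightarrow> GDERIV h w :> gradient h w"
  by (simp add: C1_on_def GDERIV_gradient)

lemma C1_on_continuous_on: "C1_on U h \<Longrightarrow> continuous_on U h"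
  unfolding C1_on_def
  by (meson continuous_at_imp_continuous_on differentiable_imp_continuous_within)

lemma C1_on_continuous_on_gradient:
  fixes h :: "'a::euclidean_space \<Rightarrow> real"
  assumes "C1_on U h"
  shows "continuous_on U (gradient h)"
proof (rule continuous_on_componentwise[THEN iffD2], rule ballI)
  fix b :: 'a assume "b \<in> Basis"
  have "continuous_on U (\<lambda>w. frechet_derivative h (at w) b)"
    using assms by (simp add: C1_on_def)
  then show "continuous_on U (\<lambda>w. gradient h w \<bullet> b)"
    using assms
    by (simp add: C1_on_def frechet_derivative_gradient inner_commute cong: continuous_on_cong)
qed

lemma tendsto_continuous_on_open:
  fixes h :: "'a::t2_space \<Rightarrow> 'b::topological_space"
  assumes "continuous_on U h" "open U" "w \<in> U" "(a \<longlongrightarrow> w) E"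
  shows "((\<lambda>k. h (a k)) \<longlongrightarrow> h w) E"
  using assms isCont_tendsto_compose[of w h a E] continuous_on_eq_continuous_at by blast

text \<open>The linearization stays at \<open>w\<close> while both arguments move. On a small ball
  the derivative is within \<open>e\<close> of its value at \<open>w\<close>, and the mean value
  inequality along the segment from \<open>v\<close> to \<open>u\<close> transfers this to the
  increment.\<close>

lemma C1_on_strictly_differentiable:
  fixes h :: "'a::euclidean_space \<Rightarrow> 'b::euclidean_space"
  assumes U: "open U" "C1_on U h" "w \<in> U" and e: "e > 0"
  obtains d where "d > 0" "ball w d \<subseteq> U"
    "\<And>u v. u \<in> ball w d \<Longrightarrow> v \<in> ball w d \<Longrightarrow>
       norm (h u - h v - frechet_derivative h (at w) (u - v)) \<le> e * norm (u - v)"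
proof -
  let ?A = "\<lambda>u. frechet_derivative h (at u)"
  \<comment> \<open>The operator norm is at most the sum of the norms on the basis, hence an equal
    share of \<open>e\<close> for each basis vector.\<close>
  define e' where "e' = e / DIM('a)"
  have e': "e' > 0" using e by (simp add: e'_def)
  have "\<forall>b\<in>Basis. eventually (\<lambda>u. dist (?A u b) (?A w b) < e') (at w)"
    using U e' unfolding C1_on_def
    by (metis continuous_on_eq_continuous_at isCont_def tendstoD)
  then have "eventually (\<lambda>u. \<forall>b\<in>Basis. dist (?A u b) (?A w b) < e') (at w)"
    by (intro eventually_ball_finite) auto
  then obtain d1 where d1: "d1 > 0"
      "\<And>u b. u \<noteq> w \<Longrightarrow> dist u w < d1 \<Longrightarrow> b \<in> Basis \<Longrightarrow> dist (?A u b) (?A w b) < e'"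
    unfolding eventually_at by blast
  obtain d2 where d2: "d2 > 0" "ball w d2 \<subseteq> U"
    using U openE by blast
  define d where "d = min d1 d2"
  have d: "d > 0" "ball w d \<subseteq> U"
    using d1 d2 by (auto simp: d_def)
  have der: "(h has_derivative ?A u) (at u)" if "u \<in> U" for u
    using that U(2) by (simp add: C1_on_def frechet_derivative_works)
  have bound: "onorm (?A u - ?A w) \<le> e" if u: "u \<in> ball w d" for u
  proof -
    have "u \<in> U"
      using u d(2) by blast
    then have "bounded_linear (?A u - ?A w)"
      unfolding fun_diff_def
      by (intro bounded_linear_sub has_derivative_bounded_linear[OF der] U(3))
    then have "onorm (?A u - ?A w) \<le> (\<Sum>b\<in>Basis. norm ((?A u - ?A w) b))"
      by (rule onorm_componentwise)
    also have "\<dots> \<le> (\<Sum>b\<in>(Basis::'a set). e')"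
    proof (rule sum_mono)
      fix b :: 'a assume b: "b \<in> Basis"
      show "norm ((?A u - ?A w) b) \<le> e'"
      proof (cases "u = w")
        case False
        then show ?thesis
          using d1(2)[of u b] u b by (simp add: d_def dist_commute dist_norm norm_minus_commute)
      qed (use e' in simp)
    qed
    also have "\<dots> = e"
      by (simp add: e'_def)
    finally show ?thesis .
  qed
  have "norm (h u - h v - ?A w (u - v)) \<le> e * norm (u - v)"
    if uv: "u \<in> ball w d" "v \<in> ball w d" for u v
  proof -
    have "norm (h u - h v - ?A w (u - v)) \<le> norm (u - v) * e"
    proof (rule differentiable_bound_linearization)
      show "v + t *\<^sub>R (u - v) \<in> ball w d" if "t \<in> {0..1}" for t
      proof -
        have "(1 - t) *\<^sub>R v + t *\<^sub>R u \<in> ball w d"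
          using uv that by (intro convexD) auto
        then show ?thesis by (simp add: algebra_simps)
      qed
      show "(h has_derivative ?A u) (at u within ball w d)" if "u \<in> ball w d" for u
        using der that d(2) has_derivative_at_withinI by blast
    qed (use bound d in auto)
    then show ?thesis by (simp add: mult.commute)
  qed
  then show ?thesis
    using that d by blast
qed

text \<open>\<open>\<beta>\<close> may be unbounded; only the product
  \<open>\<beta> k *\<^sub>R (u k - v k)\<close> is controlled. The linearization error is a small
  multiple of \<open>norm (u k - v k)\<close>, so after scaling it is a small multiple of a bounded
  quantity.\<close>

lemma tendsto_scaled_difference:
  fixes h :: "'a::euclidean_space \<Rightarrow> 'b::euclidean_space"
  assumes U: "open U" "C1_on U h" "w \<in> U"
    and uv: "u \<longlonglongrightarrow> w" "v \<longlonglongrightarrow> w"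
    and lim: "(\<lambda>k. \<beta> k *\<^sub>R (u k - v k)) \<longlonglongrightarrow> p"
  shows "(\<lambda>k. \<beta> k *\<^sub>R (h (u k) - h (v k))) \<longlonglongrightarrow> frechet_derivative h (at w) p"
proof -
  let ?A = "frechet_derivative h (at w)"
  have "(h has_derivative ?A) (at w)"
    using U by (simp add: C1_on_def frechet_derivative_works)
  then have A: "bounded_linear ?A"
    by (rule has_derivative_bounded_linear)
  then have lin: "linear ?A"
    by (simp add: bounded_linear.linear)
  have Alim: "(\<lambda>k. ?A (\<beta> k *\<^sub>R (u k - v k))) \<longlonglongrightarrow> ?A p"
    by (rule bounded_linear.tendsto[OF A lim])
  obtain B where B: "B > 0" "\<And>k. norm (\<beta> k *\<^sub>R (u k - v k)) \<le> B"
    using BseqE[OF convergent_imp_Bseq[OF convergentI[OF lim]]] by metis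
  have "(\<lambda>k. \<beta> k *\<^sub>R (h (u k) - h (v k)) - ?A (\<beta> k *\<^sub>R (u k - v k))) \<longlonglongrightarrow> 0"
  proof (rule tendstoI)
    fix e :: real assume e: "e > 0"
    then have "e / (2 * B) > 0" using B by simp
    then obtain d where d: "d > 0" "ball w d \<subseteq> U" "\<And>u v. u \<in> ball w d \<Longrightarrow> v \<in> ball w d \<Longrightarrow>
       norm (h u - h v - ?A (u - v)) \<le> e / (2 * B) * norm (u - v)"
      using C1_on_strictly_differentiable[OF U] by metis
    have "eventually (\<lambda>k. u k \<in> ball w d) sequentially" "eventually (\<lambda>k. v k \<in> ball w d) sequentially"
      using uv d(1) by (auto simp: tendsto_iff dist_commute)
    then show "eventually (\<lambda>k. dist (\<beta> k *\<^sub>R (h (u k) - h (v k)) - ?A (\<beta> k *\<^sub>R (u k - v k))) 0 < e)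
        sequentially"
    proof eventually_elim
      case (elim k)
      have "norm (\<beta> k *\<^sub>R (h (u k) - h (v k)) - ?A (\<beta> k *\<^sub>R (u k - v k)))
          = \<bar>\<beta> k\<bar> * norm (h (u k) - h (v k) - ?A (u k - v k))"
        by (simp add: linear_cmul[OF lin] flip: scaleR_diff_right)
      also have "\<dots> \<le> \<bar>\<beta> k\<bar> * (e / (2 * B) * norm (u k - v k))"
        using d(3) elim by (intro mult_left_mono) auto
      also have "\<dots> = e / (2 * B) * norm (\<beta> k *\<^sub>R (u k - v k))"
        by simp
      also have "\<dots> \<le> e / (2 * B) * B"
        using B e by (intro mult_left_mono) auto
      also have "\<dots> < e"
        using B e by simp
      finally show ?case by simp
    qed
  qed
  from tendsto_add[OF this Alim] show ?thesis by simp
qed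

text \<open>Both Hessian forms approximate the second difference
  \<open>f (w + t(u + v)) - f (w + t u) - f (w + t v) + f w\<close> up to \<open>o(t\<^sup>2)\<close>.\<close>

lemma Hessian_symmetric:
  fixes f :: "'a::euclidean_space \<Rightarrow> real"
  assumes U: "open U" "C2_on U f" "w \<in> U"
  shows "frechet_derivative (gradient f) (at w) u \<bullet> v = frechet_derivative (gradient f) (at w) v \<bullet> u"
proof -
  let ?H = "frechet_derivative (gradient f) (at w)"
  have C1: "C1_on U f" "C1_on U (gradient f)"
    using U by (auto simp: C2_on_def)
  have lin: "linear ?H"
    using C1(2) U(3) linear_frechet_derivative by (auto simp: C1_on_def)
  have approx: "\<bar>(f (w + t *\<^sub>R u + t *\<^sub>R v) - f (w + t *\<^sub>R u) - (f (w + t *\<^sub>R v) - f w)) - t\<^sup>2 * (?H v \<bullet> u)\<bar>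
      \<le> t\<^sup>2 * (e * norm v * norm u)"
    if d: "d > 0" "ball w d \<subseteq> U" "\<And>a b. a \<in> ball w d \<Longrightarrow> b \<in> ball w d \<Longrightarrow>
       norm (gradient f a - gradient f b - ?H (a - b)) \<le> e * norm (a - b)"
    and t: "t > 0" "t * (norm u + norm v) < d" for d t e u v
  proof -
    \<comment> \<open>\<open>\<phi> 1 - \<phi> 0\<close> is the second difference. The mean value
      theorem in direction \<open>u\<close> turns it into a first difference \<open>D r\<close> of
      the gradient in direction \<open>v\<close>, to which the linearization at \<open>w\<close>
      applies.\<close>
    define \<phi> where "\<phi> r = f (w + r *\<^sub>R t *\<^sub>R u + t *\<^sub>R v) - f (w + r *\<^sub>R t *\<^sub>R u)" for r
    define D where "D r = gradient f (w + r *\<^sub>R t *\<^sub>R u + t *\<^sub>R v) - gradient f (w + r *\<^sub>R t *\<^sub>R u)" for r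
    have ball_iff: "w + a \<in> ball w d \<longleftrightarrow> norm a < d" for a
      by (simp add: dist_norm)
    have inball: "w + r *\<^sub>R t *\<^sub>R u + t *\<^sub>R v \<in> ball w d" "w + r *\<^sub>R t *\<^sub>R u \<in> ball w d"
      if r: "0 \<le> r" "r \<le> 1" for r
    proof -
      have "norm (r *\<^sub>R t *\<^sub>R u) \<le> t * norm u"
        using r t by (simp add: mult_left_le_one_le)
      moreover have "norm (t *\<^sub>R v) = t * norm v" using t by simp
      moreover have "0 \<le> t * norm v" using t by simp
      moreover have "t * norm u + t * norm v < d" using t by (simp add: distrib_left)
      ultimately have "norm (r *\<^sub>R t *\<^sub>R u + t *\<^sub>R v) < d" "norm (r *\<^sub>R t *\<^sub>R u) < d"
        using norm_triangle_ineq[of "r *\<^sub>R t *\<^sub>R u" "t *\<^sub>R v"] by linarith+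
      then show "w + r *\<^sub>R t *\<^sub>R u + t *\<^sub>R v \<in> ball w d" "w + r *\<^sub>R t *\<^sub>R u \<in> ball w d"
        by (simp_all only: ball_iff add.assoc)
    qed
    have g: "(f has_derivative (\<lambda>h. h \<bullet> gradient f a)) (at a)" if "a \<in> ball w d" for a
      using C1_on_GDERIV[OF C1(1)] that d(2) by (auto simp: gderiv_def)
    have der: "(\<phi> has_derivative (\<lambda>h. h * (t * (D r \<bullet> u)))) (at r)" if r: "0 \<le> r" "r \<le> 1" for r
    proof -
      have 1: "((\<lambda>r. w + r *\<^sub>R t *\<^sub>R u + t *\<^sub>R v) has_derivative (\<lambda>h. h *\<^sub>R t *\<^sub>R u)) (at r)"
        and 2: "((\<lambda>r. w + r *\<^sub>R t *\<^sub>R u) has_derivative (\<lambda>h. h *\<^sub>R t *\<^sub>R u)) (at r)"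
        by (auto intro!: derivative_eq_intros)
      show ?thesis
        unfolding \<phi>_def D_def
        using has_derivative_diff[OF has_derivative_compose[OF 1 g[OF inball(1)[OF r]]]
            has_derivative_compose[OF 2 g[OF inball(2)[OF r]]]]
        by (simp add: inner_diff_left inner_commute algebra_simps)
    qed
    have "\<exists>r\<in>{0<..<1}. \<phi> 1 - \<phi> 0 = (1 - 0) * (t * (D r \<bullet> u))"
      using der by (intro mvt_simple) (auto intro: has_derivative_at_withinI)
    then obtain r where r: "0 < r" "r < 1" "\<phi> 1 - \<phi> 0 = t * (D r \<bullet> u)"
      by auto
    have "norm (D r - ?H (t *\<^sub>R v)) \<le> e * norm (t *\<^sub>R v)"
      using d(3)[OF inball(1)[of r] inball(2)[of r]] r by (simp add: D_def)
    then have "norm (D r - t *\<^sub>R ?H v) \<le> e * (t * norm v)"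
      using t by (simp add: linear_cmul[OF lin])
    moreover have "\<bar>(D r - t *\<^sub>R ?H v) \<bullet> u\<bar> \<le> norm (D r - t *\<^sub>R ?H v) * norm u"
      by (rule Cauchy_Schwarz_ineq2)
    ultimately have "\<bar>(D r - t *\<^sub>R ?H v) \<bullet> u\<bar> \<le> e * (t * norm v) * norm u"
      by (meson mult_right_mono norm_ge_zero order_trans)
    then have "t * \<bar>(D r - t *\<^sub>R ?H v) \<bullet> u\<bar> \<le> t * (e * (t * norm v) * norm u)"
      using t by (intro mult_left_mono) auto
    moreover have "t * \<bar>(D r - t *\<^sub>R ?H v) \<bullet> u\<bar> = \<bar>t * (D r \<bullet> u) - t\<^sup>2 * (?H v \<bullet> u)\<bar>"
    proof -
      have "t * (D r \<bullet> u) - t\<^sup>2 * (?H v \<bullet> u) = t * ((D r - t *\<^sub>R ?H v) \<bullet> u)"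
        by (simp add: inner_diff_left power2_eq_square algebra_simps)
      then show ?thesis
        using t by (simp only: abs_mult abs_of_pos)
    qed
    ultimately show ?thesis
      using r(3) by (simp add: \<phi>_def power2_eq_square mult_ac)
  qed
  have le: "\<bar>?H u \<bullet> v - ?H v \<bullet> u\<bar> \<le> e * (2 * norm u * norm v)" if e: "e > 0" for e
  proof -
    obtain d where d: "d > 0" "ball w d \<subseteq> U" "\<And>a b. a \<in> ball w d \<Longrightarrow> b \<in> ball w d \<Longrightarrow>
       norm (gradient f a - gradient f b - ?H (a - b)) \<le> e * norm (a - b)"
      using C1_on_strictly_differentiable[OF U(1) C1(2) U(3) e] by metis
    \<comment> \<open>Adding 1 keeps the denominator positive when both vectors vanish and makes
      \<open>t * (norm u + norm v) < d\<close> strict.\<close>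
    define t where "t = d / (norm u + norm v + 1)"
    have t: "t > 0" using d(1) by (simp add: t_def add_nonneg_pos)
    have "t * (norm u + norm v + 1) = d"
      by (simp add: t_def add_nonneg_eq_0_iff)
    then have t': "t * (norm u + norm v) < d" "t * (norm v + norm u) < d"
      using t by (auto simp: algebra_simps)
    \<comment> \<open>The second difference is symmetric in \<open>u\<close> and \<open>v\<close>,
      so both Hessian forms approximate the same number.\<close>
    have comm: "w + t *\<^sub>R v + t *\<^sub>R u = w + t *\<^sub>R u + t *\<^sub>R v"
      by (simp add: add_ac)
    have "\<bar>t\<^sup>2 * (?H u \<bullet> v) - t\<^sup>2 * (?H v \<bullet> u)\<bar> \<le> t\<^sup>2 * (e * norm v * norm u) + t\<^sup>2 * (e * norm u * norm v)"
      using approx[OF d t t'(1)] approx[OF d t t'(2), unfolded comm] by linarith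
    moreover have "\<bar>t\<^sup>2 * (?H u \<bullet> v) - t\<^sup>2 * (?H v \<bullet> u)\<bar> = t\<^sup>2 * \<bar>?H u \<bullet> v - ?H v \<bullet> u\<bar>"
      by (metis abs_mult abs_power2 right_diff_distrib)
    ultimately have "t\<^sup>2 * \<bar>?H u \<bullet> v - ?H v \<bullet> u\<bar> \<le> t\<^sup>2 * (e * (2 * norm u * norm v))"
      by (simp add: algebra_simps)
    then show ?thesis
      using t by simp
  qed
  have "\<bar>?H u \<bullet> v - ?H v \<bullet> u\<bar> \<le> 0 + e" if e: "e > 0" for e
  proof -
    let ?e = "e / (2 * norm u * norm v + 1)"
    have pos: "2 * norm u * norm v + 1 > 0" by (simp add: add_nonneg_pos)
    then have "?e > 0" using e by simp
    then have "\<bar>?H u \<bullet> v - ?H v \<bullet> u\<bar> \<le> ?e * (2 * norm u * norm v)"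
      by (rule le)
    also have "\<dots> \<le> ?e * (2 * norm u * norm v + 1)"
      using e pos by (intro mult_left_mono) auto
    also have "\<dots> = e" using pos by simp
    finally show ?thesis by simp
  qed
  then show ?thesis
    using field_le_epsilon[of "\<bar>?H u \<bullet> v - ?H v \<bullet> u\<bar>" 0] by simp
qed

section \<open>The gap function and normal cones\<close>

lemma convex_on_above_tangent:
  assumes "convex_on UNIV h" "GDERIV h w :> d"
  shows "h w + (u - w) \<bullet> d \<le> h u"
proof -
  define \<phi> where "\<phi> t = h (w + t *\<^sub>R (u - w))" for t :: real
  have "convex_on UNIV \<phi>"
  proof (rule convex_onI)
    fix t x y :: real assume t: "0 < t" "t < 1"
    have "w + ((1 - t) * x + t * y) *\<^sub>R (u - w)
        = (1 - t) *\<^sub>R (w + x *\<^sub>R (u - w)) + t *\<^sub>R (w + y *\<^sub>R (u - w))"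
      by (simp add: algebra_simps)
    then show "\<phi> ((1 - t) *\<^sub>R x + t *\<^sub>R y) \<le> (1 - t) * \<phi> x + t * \<phi> y"
      unfolding \<phi>_def using convex_onD[OF assms(1), of t] t by simp
  qed simp
  moreover have "(\<phi> has_real_derivative (u - w) \<bullet> d) (at 0)"
  proof -
    have "((\<lambda>t. w + t *\<^sub>R (u - w)) has_derivative (\<lambda>t. t *\<^sub>R (u - w))) (at 0)"
      by (auto intro!: derivative_eq_intros)
    from has_derivative_compose[OF this, of h "\<lambda>v. v \<bullet> d"] assms(2) show ?thesis
      by (simp add: gderiv_def has_field_derivative_def \<phi>_def[abs_def] mult_commute_abs)
  qed
  ultimately have "\<phi> 1 - \<phi> 0 \<ge> (u - w) \<bullet> d * (1 - 0)"
    by (intro convex_on_imp_above_tangent[of UNIV]) auto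
  then show ?thesis
    by (simp add: \<phi>_def)
qed

lemma GDERIV_local_min:
  assumes "GDERIV h w :> d" and min: "\<And>u. h w \<le> h u"
  shows "d = 0"
proof -
  have "(\<lambda>v. v \<bullet> d) = (\<lambda>v. 0)"
    using assms(1) min by (intro differential_zero_maxmin[of w UNIV h]) (auto simp: gderiv_def)
  then show ?thesis
    by (metis inner_eq_zero_iff)
qed

lemma GDERIV_norm_diff_square:
  "GDERIV (\<lambda>u. c * (norm (u - y))\<^sup>2) w :> (2 * c) *\<^sub>R (w - y)"
  unfolding gderiv_def power2_norm_eq_inner
  by (auto intro!: derivative_eq_intros simp: inner_commute algebra_simps)

text \<open>The tangent at \<open>y\<close> bounds \<open>h\<close> from below by an affine
  function, so the quadratic term makes \<open>\<phi>\<close> coercive and a minimizer exists. The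
  last bound is the tangent inequality at \<open>\<theta>\<close> with the slope from the optimality
  condition. It is twice as strong as what minimality alone yields, and the gap estimate needs this
  surplus.\<close>

lemma arg_min_proximal:
  fixes h :: "'a::euclidean_space \<Rightarrow> real" and y :: 'a
  assumes conv: "convex_on UNIV h" and diff: "\<And>u. GDERIV h u :> h' u" and \<gamma>: "\<gamma> > 0"
  defines "\<phi> \<equiv> \<lambda>u. h u + 1 / (2 * \<gamma>) * (norm (u - y))\<^sup>2"
  defines "\<theta> \<equiv> ARG_MIN \<phi> u. True"
  shows "\<phi> \<theta> \<le> \<phi> u"
    and "h' \<theta> = (1 / \<gamma>) *\<^sub>R (y - \<theta>)"
    and "(norm (\<theta> - y))\<^sup>2 / \<gamma> \<le> h y - h \<theta>"
proof -
  have der: "GDERIV \<phi> u :> h' u + (1 / \<gamma>) *\<^sub>R (u - y)" for u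
    unfolding \<phi>_def by (rule GDERIV_subst[OF GDERIV_add[OF diff GDERIV_norm_diff_square]]) simp
  have "isCont \<phi> u" for u
    using der has_derivative_continuous unfolding gderiv_def by blast
  then have cont: "continuous_on S \<phi>" for S
    by (simp add: continuous_at_imp_continuous_on)
  \<comment> \<open>Outside this ball the quadratic term outweighs the slope
    \<open>norm (h' y)\<close> of the tangent at \<open>y\<close>, so
    \<open>\<phi> y \<le> \<phi> u\<close> there.\<close>
  let ?R = "2 * \<gamma> * norm (h' y)"
  have "?R \<ge> 0" using \<gamma> by simp
  then obtain u0 where u0: "u0 \<in> cball y ?R" "\<And>u. u \<in> cball y ?R \<Longrightarrow> \<phi> u0 \<le> \<phi> u"
    using continuous_attains_inf[OF compact_cball _ cont, of y ?R] by auto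
  have min: "\<phi> u0 \<le> \<phi> u" for u
  proof (cases "u \<in> cball y ?R")
    case False
    then have R: "?R \<le> norm (u - y)"
      by (simp add: dist_norm norm_minus_commute)
    have "h y - norm (u - y) * norm (h' y) \<le> h u"
      using convex_on_above_tangent[OF conv diff, of y u] Cauchy_Schwarz_ineq2[of "u - y" "h' y"]
      by linarith
    moreover have "norm (u - y) * norm (h' y) \<le> norm (u - y) * (norm (u - y) / (2 * \<gamma>))"
      using R \<gamma> by (intro mult_left_mono) (auto simp: field_simps)
    ultimately have "\<phi> y \<le> \<phi> u"
      by (simp add: \<phi>_def power2_eq_square)
    moreover have "y \<in> cball y ?R" using \<gamma> by simp
    ultimately show ?thesis
      using u0(2) by fastforce
  qed (use u0 in blast)
  show all: "\<phi> \<theta> \<le> \<phi> u" for u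
    unfolding \<theta>_def by (rule arg_minI[where x = u0]) (use min in \<open>auto simp: not_less\<close>)
  show d: "h' \<theta> = (1 / \<gamma>) *\<^sub>R (y - \<theta>)"
    using GDERIV_local_min[OF der all] by (simp add: algebra_simps eq_neg_iff_add_eq_0 add_eq_0_iff)
  show "(norm (\<theta> - y))\<^sup>2 / \<gamma> \<le> h y - h \<theta>"
    using convex_on_above_tangent[OF conv diff, of \<theta> y]
    by (simp add: d power2_norm_eq_inner norm_minus_commute[of \<theta>])
qed

lemma nonneg_orthant: "{l::real^'q. 0 \<le> l} \<noteq> {}" "convex {l::real^'q. 0 \<le> l}" "closed {l::real^'q. 0 \<le> l}"
  by (auto simp: convex_def less_eq_vec_def closed_positive_orthant intro: exI[of _ 0])

lemma lambda_star_nth: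
  fixes g :: "(real^'a) \<times> (real^'b) \<Rightarrow> real^'c"
  shows "lambda_star g \<gamma>2 x y z $ i = max 0 (z $ i + \<gamma>2 * g (x, y) $ i)"
proof -
  let ?a = "z + \<gamma>2 *\<^sub>R g (x, y)"
  have eq: "(\<chi> i. max 0 (?a $ i)) = closest_point {l. 0 \<le> l} ?a"
  proof (rule closest_point_unique[OF nonneg_orthant(2,3)])
    show "\<forall>l\<in>{l. 0 \<le> l}. dist ?a (\<chi> i. max 0 (?a $ i)) \<le> dist ?a l"
    proof
      fix l :: "real^'c" assume "l \<in> {l. 0 \<le> l}"
      then have l: "0 \<le> l $ i" for i by (simp add: less_eq_vec_def)
      have "\<bar>(?a - (\<chi> i. max 0 (?a $ i))) $ i\<bar> \<le> \<bar>(?a - l) $ i\<bar>" for i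
        using l[of i] by (simp add: abs_if max_def)
      then show "dist ?a (\<chi> i. max 0 (?a $ i)) \<le> dist ?a l"
        unfolding dist_norm by (intro norm_le_componentwise_cart) simp
    qed
  qed (simp add: less_eq_vec_def)
  show ?thesis
    unfolding lambda_star_def eq[symmetric] by simp
qed

text \<open>The supremum is at least the objective at \<open>(\<theta>0, l0)\<close>. The projection
  and proximal inequalities give the squares divided by \<open>\<gamma>2\<close> and
  \<open>\<gamma>1\<close>; the penalties in the objective consume half of each.\<close>

lemma gap_lower_bound:
  fixes f :: "(real^'n) \<times> (real^'m) \<Rightarrow> real" and g :: "(real^'n) \<times> (real^'m) \<Rightarrow> real^'q"
    and y :: "real^'m"
  assumes conv: "convex_on UNIV (\<lambda>\<theta>. Lag f g x \<theta> z)"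
    and diff: "\<And>\<theta>. GDERIV (\<lambda>\<theta>. Lag f g x \<theta> z) \<theta> :> L' \<theta>"
    and \<gamma>: "\<gamma>1 > 0" "\<gamma>2 > 0" and z: "0 \<le> z"
  defines "\<theta>0 \<equiv> theta_star f g \<gamma>1 x y z" and "l0 \<equiv> lambda_star g \<gamma>2 x y z"
  shows "(norm (l0 - z))\<^sup>2 / (2 * \<gamma>2) + (norm (\<theta>0 - y))\<^sup>2 / (2 * \<gamma>1) \<le> gap f g \<gamma>1 \<gamma>2 x y z"
proof -
  let ?a = "z + \<gamma>2 *\<^sub>R g (x, y)"
  let ?L = "\<lambda>\<theta>. Lag f g x \<theta> z"
  define obj where "obj = (\<lambda>(\<theta>, l). Lag f g x y l - 1 / (2 * \<gamma>2) * (norm (l - z))\<^sup>2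
        - ?L \<theta> - 1 / (2 * \<gamma>1) * (norm (\<theta> - y))\<^sup>2)"
  have \<theta>0: "\<theta>0 = (ARG_MIN (\<lambda>\<theta>. ?L \<theta> + 1 / (2 * \<gamma>1) * (norm (\<theta> - y))\<^sup>2) \<theta>. True)"
    by (simp add: \<theta>0_def theta_star_def Lag_def)
  note prox = arg_min_proximal[OF conv diff \<gamma>(1), of y, folded \<theta>0]
  \<comment> \<open>Completing the square bounds the \<open>l\<close>-part of the objective by a
    constant; the discarded term is the squared distance from \<open>l\<close> to
    \<open>?a\<close>.\<close>
  have square: "(norm (l - z))\<^sup>2 = (norm (l - ?a))\<^sup>2 + 2 * \<gamma>2 * (l \<bullet> g (x, y)) - (norm ?a)\<^sup>2 + (norm z)\<^sup>2" for l
    by (simp add: power2_norm_eq_inner algebra_simps inner_commute)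
  have ub: "Lag f g x y l - 1 / (2 * \<gamma>2) * (norm (l - z))\<^sup>2
      \<le> f (x, y) + ((norm ?a)\<^sup>2 - (norm z)\<^sup>2) / (2 * \<gamma>2)" for l
  proof -
    have "l \<bullet> g (x, y) - 1 / (2 * \<gamma>2) * (norm (l - z))\<^sup>2
        = ((norm ?a)\<^sup>2 - (norm z)\<^sup>2 - (norm (l - ?a))\<^sup>2) / (2 * \<gamma>2)"
      unfolding square using \<gamma> by (simp add: field_simps)
    also have "\<dots> \<le> ((norm ?a)\<^sup>2 - (norm z)\<^sup>2) / (2 * \<gamma>2)"
      using \<gamma> by (intro divide_right_mono) auto
    finally show ?thesis by (simp add: Lag_def)
  qed
  \<comment> \<open>A real \<open>SUP\<close> is sure to dominate its members only over a set that
    is bounded above.\<close>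
  have "bdd_above (obj ` (UNIV \<times> {l. 0 \<le> l}))"
  proof (rule bdd_aboveI2)
    fix p :: "(real^'m) \<times> (real^'q)"
    show "obj p \<le> f (x, y) + ((norm ?a)\<^sup>2 - (norm z)\<^sup>2) / (2 * \<gamma>2)
        - (?L \<theta>0 + 1 / (2 * \<gamma>1) * (norm (\<theta>0 - y))\<^sup>2)"
      using ub[of "snd p"] prox(1)[of "fst p"] by (auto simp: obj_def case_prod_beta)
  qed
  moreover have l0: "0 \<le> l0"
    by (simp add: l0_def lambda_star_nth less_eq_vec_def)
  ultimately have "obj (\<theta>0, l0) \<le> gap f g \<gamma>1 \<gamma>2 x y z"
    unfolding gap_def obj_def[symmetric] by (intro cSUP_upper) auto
  moreover have "(norm (l0 - z))\<^sup>2 / (2 * \<gamma>2) \<le> l0 \<bullet> g (x, y) - 1 / (2 * \<gamma>2) * (norm (l0 - z))\<^sup>2 - z \<bullet> g (x, y)"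
  proof -
    have "(?a - l0) \<bullet> (z - l0) \<le> 0"
      unfolding l0_def lambda_star_def using z closest_point_dot[OF nonneg_orthant(2,3)] by blast
    then have "(norm (l0 - z))\<^sup>2 \<le> \<gamma>2 * (l0 \<bullet> g (x, y) - z \<bullet> g (x, y))"
      by (simp add: power2_norm_eq_inner algebra_simps inner_commute)
    then have "(norm (l0 - z))\<^sup>2 / \<gamma>2 \<le> l0 \<bullet> g (x, y) - z \<bullet> g (x, y)"
      using \<gamma> by (simp add: field_simps)
    then show ?thesis
      by (simp add: field_simps)
  qed
  moreover have "(norm (\<theta>0 - y))\<^sup>2 / (2 * \<gamma>1) \<le> ?L y - ?L \<theta>0 - 1 / (2 * \<gamma>1) * (norm (\<theta>0 - y))\<^sup>2"
    using prox(3) by (simp add: field_simps)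
  ultimately show ?thesis
    by (simp add: obj_def Lag_def)
qed

text \<open>A vector outside the (polyhedral, hence closed) cone of active gradients is separated from it by
  some \<open>d\<close>; the constraint qualification gives a strictly feasible direction \<open>e\<close>, and a small multiple
  of \<open>- d - \<tau> e\<close> is a feasible step that contradicts normality.\<close>

lemma normal_cone_of_system:
  fixes c :: "'a::euclidean_space \<Rightarrow> real^'k"
  assumes mfcq: "MFCQ_ineq c w"
    and diff: "\<And>j. GDERIV (\<lambda>u. c u $ j) w :> gradient (\<lambda>u. c u $ j) w"
    and v: "\<And>u. c u \<le> 0 \<Longrightarrow> v \<bullet> (u - w) \<le> 0"
  obtains \<mu> where "0 \<le> \<mu>" "jacobian_T c w \<mu> = v" "\<And>j. \<mu> $ j * c w $ j = 0"
proof -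
  define J where "J = {j. c w $ j = 0}"
  define a where "a j = gradient (\<lambda>u. c u $ j) w" for j
  have feas: "c w $ j \<le> 0" for j
    using mfcq by (auto simp: MFCQ_ineq_def MFCQ_def)
  have indep: "\<forall>j\<in>J. \<nu> j = 0" if "\<forall>j\<in>J. 0 \<le> \<nu> j" "(\<Sum>j\<in>J. \<nu> j *\<^sub>R a j) = 0" for \<nu>
  proof -
    have J: "{j \<in> UNIV. c w $ j = 0} = J"
      by (simp add: J_def)
    show ?thesis
      using mfcq[unfolded MFCQ_ineq_def MFCQ_def J, THEN conjunct2, THEN conjunct2,
          THEN spec, THEN spec, of \<nu> "\<lambda>_. 0"] that
      unfolding a_def by simp
  qed
  \<comment> \<open>Separation speaks of hulls, the conclusion of coefficients. These sets carry
    explicit coefficients, indexed by \<open>J\<close> and not by the set of gradients because two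
    constraints may share a gradient.\<close>
  define K where "K = {(\<Sum>j\<in>J. \<nu> j *\<^sub>R a j) |\<nu>. \<forall>j\<in>J. 0 \<le> \<nu> j}"
  define P where "P = {(\<Sum>j\<in>J. \<nu> j *\<^sub>R a j) |\<nu>. (\<forall>j\<in>J. 0 \<le> \<nu> j) \<and> (\<Sum>j\<in>J. \<nu> j) = 1}"
  have K_E: "\<exists>\<nu>. (\<forall>j\<in>J. 0 \<le> \<nu> j) \<and> p = (\<Sum>j\<in>J. \<nu> j *\<^sub>R a j)" if "p \<in> K" for p
    using that by (auto simp: K_def)
  have P_E: "\<exists>\<nu>. (\<forall>j\<in>J. 0 \<le> \<nu> j) \<and> sum \<nu> J = 1 \<and> p = (\<Sum>j\<in>J. \<nu> j *\<^sub>R a j)" if "p \<in> P" for p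
    using that by (auto simp: P_def)
  have unit: "a j = (\<Sum>i\<in>J. (if i = j then 1 else 0) *\<^sub>R a i)" if "j \<in> J" for j
    using that by (simp add: if_distrib[of "\<lambda>r. r *\<^sub>R _"] sum.delta cong: if_cong)
  have "convex_cone hull (a ` J) \<subseteq> K"
  proof (rule hull_minimal)
    show "a ` J \<subseteq> K"
    proof
      fix p assume "p \<in> a ` J"
      then obtain j where j: "j \<in> J" "p = a j" by blast
      then show "p \<in> K"
        unfolding K_def using unit[of j]
        by (intro CollectI exI[of _ "\<lambda>i. if i = j then 1 else 0"]) simp
    qed
    have "0 \<in> K"
      unfolding K_def by (auto intro!: exI[of _ "\<lambda>_. 0"])
    moreover have "p + q \<in> K" if p: "p \<in> K" and q: "q \<in> K" for p q
    proof -
      obtain \<nu> where \<nu>: "(\<forall>j\<in>J. 0 \<le> \<nu> j) \<and> p = (\<Sum>j\<in>J. \<nu> j *\<^sub>R a j)"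
        using K_E[OF p] by (rule exE)
      obtain \<nu>' where \<nu>': "(\<forall>j\<in>J. 0 \<le> \<nu>' j) \<and> q = (\<Sum>j\<in>J. \<nu>' j *\<^sub>R a j)"
        using K_E[OF q] by (rule exE)
      have "p + q = (\<Sum>j\<in>J. (\<nu> j + \<nu>' j) *\<^sub>R a j)"
        using \<nu> \<nu>' by (simp add: scaleR_add_left sum.distrib)
      then show ?thesis
        unfolding K_def using \<nu> \<nu>' by (intro CollectI exI[of _ "\<lambda>j. \<nu> j + \<nu>' j"]) simp
    qed
    moreover have "r *\<^sub>R p \<in> K" if p: "p \<in> K" and "0 \<le> r" for p r
    proof -
      obtain \<nu> where \<nu>: "(\<forall>j\<in>J. 0 \<le> \<nu> j) \<and> p = (\<Sum>j\<in>J. \<nu> j *\<^sub>R a j)"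
        using K_E[OF p] by (rule exE)
      have "r *\<^sub>R p = (\<Sum>j\<in>J. (r * \<nu> j) *\<^sub>R a j)"
        using \<nu> by (simp add: scaleR_sum_right)
      then show ?thesis
        unfolding K_def using \<nu> \<open>0 \<le> r\<close> by (intro CollectI exI[of _ "\<lambda>j. r * \<nu> j"]) simp
    qed
    ultimately show "convex_cone K"
      by (auto simp: convex_cone_iff)
  qed
  moreover have "v \<in> convex_cone hull (a ` J)"
  proof (rule ccontr)
    let ?C = "convex_cone hull (a ` J)"
    assume "v \<notin> ?C"
    moreover have "closed ?C"
      by (simp add: polyhedron_convex_cone_hull polyhedron_imp_closed)
    ultimately obtain d b where d: "d \<bullet> v < b" "\<And>u. u \<in> ?C \<Longrightarrow> b < d \<bullet> u"
      using separating_hyperplane_closed_point[OF convex_convex_cone_hull] by blast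
    have b: "b < 0"
      using d(2)[OF convex_cone_hull_contains_0] by simp
    \<comment> \<open>If \<open>d\<close> were negative on \<open>a j\<close>, some nonnegative
      multiple of \<open>a j\<close> would attain the value \<open>b\<close>, against strict
      separation.\<close>
    have d_a: "0 \<le> d \<bullet> a j" if "j \<in> J" for j
    proof (rule ccontr)
      assume neg: "\<not> 0 \<le> d \<bullet> a j"
      have "a j \<in> ?C" using that by (simp add: hull_inc)
      then have "(b / (d \<bullet> a j)) *\<^sub>R a j \<in> ?C"
        using b neg by (intro convex_cone_hull_mul) (auto simp: divide_nonpos_neg)
      from d(2)[OF this] show False
        using neg by simp
    qed
    have "convex hull (a ` J) \<subseteq> P"
    proof (rule hull_minimal)
      show "a ` J \<subseteq> P"
      proof
        fix p assume "p \<in> a ` J"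
        then obtain j where j: "j \<in> J" "p = a j" by blast
        then show "p \<in> P"
          unfolding P_def using unit[of j]
          by (intro CollectI exI[of _ "\<lambda>i. if i = j then 1 else 0"]) simp
      qed
      show "convex P"
      proof (rule convexI)
        fix p q :: 'a and r t :: real
        assume "p \<in> P" "q \<in> P" and rt: "0 \<le> r" "0 \<le> t" "r + t = 1"
        obtain \<nu> where \<nu>: "(\<forall>j\<in>J. 0 \<le> \<nu> j) \<and> sum \<nu> J = 1 \<and> p = (\<Sum>j\<in>J. \<nu> j *\<^sub>R a j)"
          using P_E[OF \<open>p \<in> P\<close>] by (rule exE)
        obtain \<nu>' where \<nu>': "(\<forall>j\<in>J. 0 \<le> \<nu>' j) \<and> sum \<nu>' J = 1 \<and> q = (\<Sum>j\<in>J. \<nu>' j *\<^sub>R a j)"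
          using P_E[OF \<open>q \<in> P\<close>] by (rule exE)
        have "r *\<^sub>R p + t *\<^sub>R q = (\<Sum>j\<in>J. (r * \<nu> j + t * \<nu>' j) *\<^sub>R a j)"
          using \<nu> \<nu>' by (simp add: scaleR_add_left sum.distrib scaleR_sum_right)
        moreover have "(\<Sum>j\<in>J. r * \<nu> j + t * \<nu>' j) = 1"
          using \<nu> \<nu>' rt by (simp add: sum.distrib flip: sum_distrib_left)
        ultimately show "r *\<^sub>R p + t *\<^sub>R q \<in> P"
          unfolding P_def using \<nu> \<nu>' rt
          by (intro CollectI exI[of _ "\<lambda>j. r * \<nu> j + t * \<nu>' j"]) simp
      qed
    qed
    \<comment> \<open>A convex combination of active gradients equal to 0 would be a nontrivial MFCQ
      relation. Separating 0 from their convex hull thus gives the strictly feasible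
      direction.\<close>
    moreover have "0 \<notin> P"
    proof
      assume "0 \<in> P"
      obtain \<nu> where \<nu>: "(\<forall>j\<in>J. 0 \<le> \<nu> j) \<and> sum \<nu> J = 1 \<and> 0 = (\<Sum>j\<in>J. \<nu> j *\<^sub>R a j)"
        using P_E[OF \<open>0 \<in> P\<close>] by (rule exE)
      then have "\<forall>j\<in>J. \<nu> j = 0"
        by (intro indep) auto
      then have "sum \<nu> J = 0"
        by (simp add: sum.neutral)
      then show False using \<nu> by simp
    qed
    moreover have "closed (convex hull (a ` J))"
      by (simp add: compact_imp_closed finite_imp_compact_convex_hull)
    ultimately obtain e b' where e: "0 < b'" "\<And>u. u \<in> convex hull (a ` J) \<Longrightarrow> b' < e \<bullet> u"
      using separating_hyperplane_closed_0[OF convex_convex_hull] by (metis subsetD)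
    have e_a: "0 < e \<bullet> a j" if "j \<in> J" for j
      using e(2)[of "a j"] e(1) that by (simp add: hull_inc)
    have dv: "d \<bullet> v < 0" using d(1) b by simp
    \<comment> \<open>The scale lets \<open>e\<close> use up at most half of
      \<open>- (d \<bullet> v)\<close> in \<open>v \<bullet> p\<close>; adding 1 covers
      \<open>e \<bullet> v = 0\<close>.\<close>
    define \<tau> where "\<tau> = - (d \<bullet> v) / (2 * (\<bar>e \<bullet> v\<bar> + 1))"
    have \<tau>: "0 < \<tau>" using dv by (simp add: \<tau>_def divide_neg_pos)
    define p where "p = - d - \<tau> *\<^sub>R e"
    have "0 < v \<bullet> p"
    proof -
      have "\<tau> * (e \<bullet> v) \<le> \<tau> * (\<bar>e \<bullet> v\<bar> + 1)"
        using \<tau> by (intro mult_left_mono) auto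
      also have "\<dots> = - (d \<bullet> v) / 2"
        by (simp add: \<tau>_def field_simps)
      finally show ?thesis
        using dv by (simp add: p_def inner_diff_left inner_commute[of v])
    qed
    have p_a: "p \<bullet> a j < 0" if "j \<in> J" for j
      using d_a[OF that] mult_pos_pos[OF \<tau> e_a[OF that]] by (simp add: p_def inner_diff_left)
    \<comment> \<open>Along \<open>p\<close> an active constraint decreases because its derivative
      is negative; an inactive one stays negative by continuity.\<close>
    have "eventually (\<lambda>t. c (w + t *\<^sub>R p) $ j \<le> 0) (at_right 0)" for j
    proof -
      have "((\<lambda>t. w + t *\<^sub>R p) has_derivative (\<lambda>t. t *\<^sub>R p)) (at 0)"
        by (auto intro!: derivative_eq_intros)
      from has_derivative_compose[OF this, of "\<lambda>u. c u $ j" "\<lambda>v. v \<bullet> a j"] diff[of j]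
      have der: "((\<lambda>t. c (w + t *\<^sub>R p) $ j) has_real_derivative p \<bullet> a j) (at 0)"
        by (simp add: gderiv_def has_field_derivative_def a_def mult_commute_abs)
      show ?thesis
      proof (cases "j \<in> J")
        case True
        from DERIV_neg_dec_right[OF der p_a[OF True]] obtain \<delta>
          where \<delta>: "\<delta> > 0" "\<forall>h>0. h < \<delta> \<longrightarrow> c (w + 0 *\<^sub>R p) $ j > c (w + (0 + h) *\<^sub>R p) $ j"
          by blast
        then show ?thesis
          using True feas[of j] unfolding eventually_at_right_field
          by (intro exI[of _ \<delta>]) (auto simp: J_def less_imp_le)
      next
        case False
        then have "c w $ j < 0" using feas[of j] by (simp add: J_def less_le)
        moreover have "((\<lambda>t. c (w + t *\<^sub>R p) $ j) \<longlongrightarrow> c (w + 0 *\<^sub>R p) $ j) (at 0)"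
          using DERIV_isCont[OF der] by (simp add: isCont_def)
        ultimately have "eventually (\<lambda>t. c (w + t *\<^sub>R p) $ j < 0) (at 0)"
          by (intro order_tendstoD(2)) auto
        then show ?thesis
          by (auto simp: eventually_at_split elim: eventually_mono)
      qed
    qed
    then have "eventually (\<lambda>t. \<forall>j. c (w + t *\<^sub>R p) $ j \<le> 0) (at_right 0)"
      by (rule eventually_all_finite)
    then obtain \<delta> where "\<delta> > 0" "\<forall>t>0. t < \<delta> \<longrightarrow> (\<forall>j. c (w + t *\<^sub>R p) $ j \<le> 0)"
      unfolding eventually_at_right_field by blast
    then have "c (w + (\<delta> / 2) *\<^sub>R p) \<le> 0"
      by (simp add: less_eq_vec_def)
    from v[OF this] have "(\<delta> / 2) * (v \<bullet> p) \<le> 0" by simp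
    then show False
      using \<open>\<delta> > 0\<close> \<open>0 < v \<bullet> p\<close> by (simp add: mult_le_0_iff)
  qed
  ultimately have "v \<in> K" by blast
  then obtain \<nu> where \<nu>: "(\<forall>j\<in>J. 0 \<le> \<nu> j) \<and> v = (\<Sum>j\<in>J. \<nu> j *\<^sub>R a j)"
    by (rule exE[OF K_E])
  show ?thesis
  proof (rule that[of "\<chi> j. if j \<in> J then \<nu> j else 0"])
    show "jacobian_T c w (\<chi> j. if j \<in> J then \<nu> j else 0) = v"
      by (simp add: jacobian_T_def \<nu> a_def if_distrib[of "\<lambda>r. r *\<^sub>R _"] sum.If_cases cong: if_cong)
  qed (use \<nu> in \<open>auto simp: less_eq_vec_def J_def\<close>)
qed

section \<open>Normals tested along rays, and normals to the complementarity set\<close>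

lemma regular_normal_ray:
  assumes v: "v \<in> regular_normal_cone D w" and "\<delta> > 0"
    and D: "\<And>t. 0 < t \<Longrightarrow> t < \<delta> \<Longrightarrow> w + t *\<^sub>R p \<in> D"
  shows "v \<bullet> p \<le> 0"
proof (rule ccontr)
  assume pos: "\<not> v \<bullet> p \<le> 0"
  then have p: "norm p > 0" by auto
  \<comment> \<open>Half the slope of \<open>v\<close> along \<open>p\<close>: normality would push
    that slope below half of itself.\<close>
  define e where "e = (v \<bullet> p) / (2 * norm p)"
  have "e > 0" using pos p by (simp add: e_def)
  then obtain d where d: "d > 0" "\<And>u. u \<in> D \<Longrightarrow> dist u w < d \<Longrightarrow> v \<bullet> (u - w) \<le> e * norm (u - w)"
    using v unfolding regular_normal_cone_def by blast
  define t where "t = min (\<delta> / 2) (d / (2 * norm p))"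
  have t: "0 < t" "t < \<delta>" using \<open>\<delta> > 0\<close> d p by (auto simp: t_def)
  have "t * norm p \<le> d / (2 * norm p) * norm p"
    by (intro mult_right_mono) (auto simp: t_def)
  then have "t * norm p < d" using d p by simp
  then have "v \<bullet> (t *\<^sub>R p) \<le> e * norm (t *\<^sub>R p)"
    using d(2)[OF D[OF t]] t by (simp add: dist_norm)
  then have "v \<bullet> p \<le> e * norm p" using t by simp
  then show False using pos p by (simp add: e_def)
qed

text \<open>A regular normal is tested on the coordinate rays that stay in the set: upward in
  \<open>z $ i\<close> if \<open>s $ i = 0\<close>, downward if \<open>z $ i > 0\<close>, and
  likewise for \<open>s\<close>. The first two facts pass to limits because positivity persists
  nearby, the third because the pairs satisfying the alternative form a closed set. Individual signs
  at a biactive index need not survive.\<close>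

lemma limiting_normal_cone_Ccompl:
  fixes \<zeta> \<xi> z s :: "real^'a"
  assumes "(\<zeta>, \<xi>) \<in> limiting_normal_cone Ccompl (z, s)"
  shows "z $ i > 0 \<Longrightarrow> \<zeta> $ i = 0" "s $ i > 0 \<Longrightarrow> \<xi> $ i = 0"
    "\<zeta> $ i \<le> 0 \<and> \<xi> $ i \<le> 0 \<or> \<zeta> $ i * \<xi> $ i = 0"
proof -
  have ax: "axis i 1 \<bullet> v = v $ i" "v \<bullet> axis i 1 = v $ i" for v :: "real^'a"
    by (auto simp: inner_axis inner_axis')
  have reg: "(z $ i > 0 \<longrightarrow> \<zeta> $ i = 0) \<and> (s $ i > 0 \<longrightarrow> \<xi> $ i = 0) \<and>
      (\<zeta> $ i \<le> 0 \<and> \<xi> $ i \<le> 0 \<or> \<zeta> $ i * \<xi> $ i = 0)"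
    if C: "(z, s) \<in> Ccompl" and n: "(\<zeta>, \<xi>) \<in> regular_normal_cone Ccompl (z, s)"
    for z s \<zeta> \<xi> :: "real^'a"
  proof -
    have nonneg: "0 \<le> z $ j" "0 \<le> s $ j" "z $ j * s $ j = 0" for j
      using C by (auto simp: Ccompl_def less_eq_vec_def)
    have up1: "(z, s) + t *\<^sub>R (axis i 1, 0) \<in> Ccompl" if "s $ i = 0" "0 < t" for t
      using that nonneg by (auto simp: Ccompl_def less_eq_vec_def axis_def)
    have up2: "(z, s) + t *\<^sub>R (0, axis i 1) \<in> Ccompl" if "z $ i = 0" "0 < t" for t
      using that nonneg by (auto simp: Ccompl_def less_eq_vec_def axis_def)
    have down1: "(z, s) + t *\<^sub>R (- axis i 1, 0) \<in> Ccompl" if "z $ i > 0" "0 < t" "t < z $ i" for t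
      using that nonneg nonneg(3)[of i] by (auto simp: Ccompl_def less_eq_vec_def axis_def)
    have down2: "(z, s) + t *\<^sub>R (0, - axis i 1) \<in> Ccompl" if "s $ i > 0" "0 < t" "t < s $ i" for t
      using that nonneg nonneg(3)[of i] by (auto simp: Ccompl_def less_eq_vec_def axis_def)
    have z_up: "\<zeta> $ i \<le> 0" if "s $ i = 0"
      using regular_normal_ray[OF n zero_less_one up1[OF that]] by (simp add: ax)
    have s_up: "\<xi> $ i \<le> 0" if "z $ i = 0"
      using regular_normal_ray[OF n zero_less_one up2[OF that]] by (simp add: ax)
    have z_down: "0 \<le> \<zeta> $ i" if "z $ i > 0"
      using regular_normal_ray[OF n that down1[OF that]] by (simp add: ax)
    have s_down: "0 \<le> \<xi> $ i" if "s $ i > 0"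
      using regular_normal_ray[OF n that down2[OF that]] by (simp add: ax)
    show ?thesis
      using nonneg(1)[of i] nonneg(2)[of i] nonneg(3)[of i] z_up s_up z_down s_down
      by (fastforce simp: less_le)
  qed
  obtain W V where WV: "\<And>k::nat. W k \<in> Ccompl" "\<And>k. V k \<in> regular_normal_cone Ccompl (W k)"
      "W \<longlonglongrightarrow> (z, s)" "V \<longlonglongrightarrow> (\<zeta>, \<xi>)"
    using assms unfolding limiting_normal_cone_def by blast
  have reg': "(fst (W k) $ i > 0 \<longrightarrow> fst (V k) $ i = 0) \<and> (snd (W k) $ i > 0 \<longrightarrow> snd (V k) $ i = 0) \<and>
      (fst (V k) $ i \<le> 0 \<and> snd (V k) $ i \<le> 0 \<or> fst (V k) $ i * snd (V k) $ i = 0)" for k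
    using reg[of "fst (W k)" "snd (W k)" "fst (V k)" "snd (V k)"] WV(1,2)[of k] by simp
  have lims: "(\<lambda>k. fst (W k) $ i) \<longlonglongrightarrow> z $ i" "(\<lambda>k. snd (W k) $ i) \<longlonglongrightarrow> s $ i"
      "(\<lambda>k. fst (V k) $ i) \<longlonglongrightarrow> \<zeta> $ i" "(\<lambda>k. snd (V k) $ i) \<longlonglongrightarrow> \<xi> $ i"
    using tendsto_vec_nth[OF tendsto_fst[OF WV(3)]] tendsto_vec_nth[OF tendsto_snd[OF WV(3)]]
      tendsto_vec_nth[OF tendsto_fst[OF WV(4)]] tendsto_vec_nth[OF tendsto_snd[OF WV(4)]] by auto
  show "\<zeta> $ i = 0" if "z $ i > 0"
  proof (rule LIMSEQ_unique[OF lims(3)])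
    have "eventually (\<lambda>k. fst (W k) $ i > 0) sequentially"
      using order_tendstoD(1)[OF lims(1) that] .
    then have "eventually (\<lambda>k. fst (V k) $ i = 0) sequentially"
      by (rule eventually_mono) (use reg' in blast)
    then show "(\<lambda>k. fst (V k) $ i) \<longlonglongrightarrow> 0"
      by (rule tendsto_eventually)
  qed
  show "\<xi> $ i = 0" if "s $ i > 0"
  proof (rule LIMSEQ_unique[OF lims(4)])
    have "eventually (\<lambda>k. snd (W k) $ i > 0) sequentially"
      using order_tendstoD(1)[OF lims(2) that] .
    then have "eventually (\<lambda>k. snd (V k) $ i = 0) sequentially"
      by (rule eventually_mono) (use reg' in blast)
    then show "(\<lambda>k. snd (V k) $ i) \<longlonglongrightarrow> 0"
      by (rule tendsto_eventually)
  qed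
  let ?S = "{p::real\<times>real. fst p \<le> 0} \<inter> {p. snd p \<le> 0} \<union> {p. fst p * snd p = 0}"
  have "closed ?S"
    by (intro closed_Un closed_Int closed_Collect_le closed_Collect_eq continuous_intros)
  moreover have "(fst (V k) $ i, snd (V k) $ i) \<in> ?S" for k
    using reg'[of k] by auto
  moreover have "(\<lambda>k. (fst (V k) $ i, snd (V k) $ i)) \<longlonglongrightarrow> (\<zeta> $ i, \<xi> $ i)"
    by (intro tendsto_Pair lims)
  ultimately have "(\<zeta> $ i, \<xi> $ i) \<in> ?S"
    using closed_sequentially[of ?S "\<lambda>k. (fst (V k) $ i, snd (V k) $ i)"] by blast
  then show "\<zeta> $ i \<le> 0 \<and> \<xi> $ i \<le> 0 \<or> \<zeta> $ i * \<xi> $ i = 0"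
    by auto
qed

lemma convex_Omega:
  fixes G :: "(real^'a) \<times> (real^'b) \<Rightarrow> real^'c"
  assumes "\<And>j. \<exists>U. open U \<and> Omega G \<subseteq> U \<and> C1_on U (\<lambda>w. G w $ j) \<and> convex_on U (\<lambda>w. G w $ j)"
  shows "convex (Omega G)"
proof (rule convexI)
  fix p q :: "(real^'a) \<times> (real^'b)" and r t :: real
  assume pq: "p \<in> Omega G" "q \<in> Omega G" and rt: "0 \<le> r" "0 \<le> t" "r + t = 1"
  have "G (r *\<^sub>R p + t *\<^sub>R q) $ j \<le> 0" for j
  proof -
    obtain U where U: "Omega G \<subseteq> U" "convex_on U (\<lambda>w. G w $ j)"
      using assms by blast
    then have "G (r *\<^sub>R p + t *\<^sub>R q) $ j \<le> r * G p $ j + t * G q $ j"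
      using pq rt unfolding convex_on_def by blast
    moreover have "G p $ j \<le> 0" "G q $ j \<le> 0"
      using pq by (auto simp: Omega_def less_eq_vec_def)
    then have "r * G p $ j + t * G q $ j \<le> 0"
      using rt by (simp add: add_nonpos_nonpos mult_nonneg_nonpos)
    ultimately show ?thesis by linarith
  qed
  then show "r *\<^sub>R p + t *\<^sub>R q \<in> Omega G"
    by (cases p, cases q) (simp add: Omega_def less_eq_vec_def)
qed

section \<open>Derivatives of the Lagrangian and multipliers\<close>

text \<open>The gradient of the Lagrangian in \<open>(x, y)\<close> as an explicit combination, so
  that limits and derivatives jointly in the point and in \<open>z\<close> can be read off.\<close>

definition lag_gradient ::
  "('a::euclidean_space \<Rightarrow> real) \<Rightarrow> ('a \<Rightarrow> real^'q) \<Rightarrow> real^'q \<Rightarrow> 'a \<Rightarrow> 'a" where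
  "lag_gradient f g z w = gradient f w + jacobian_T g w z"

definition lag_hessian ::
  "('a::euclidean_space \<Rightarrow> real) \<Rightarrow> ('a \<Rightarrow> real^'q) \<Rightarrow> real^'q \<Rightarrow> 'a \<Rightarrow> 'a \<Rightarrow> 'a" where
  "lag_hessian f g z w v = frechet_derivative (gradient f) (at w) v
     + (\<Sum>i\<in>UNIV. z $ i *\<^sub>R frechet_derivative (gradient (\<lambda>u. g u $ i)) (at w) v)"

lemma jacobian_T_add: "jacobian_T h w (a + b) = jacobian_T h w a + jacobian_T h w b"
  by (simp add: jacobian_T_def scaleR_add_left sum.distrib)

lemma jacobian_T_scaleR: "jacobian_T h w (r *\<^sub>R a) = r *\<^sub>R jacobian_T h w a"
  by (simp add: jacobian_T_def scaleR_sum_right)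

lemma jacobian_T_diff: "jacobian_T h w (a - b) = jacobian_T h w a - jacobian_T h w b"
  by (simp add: jacobian_T_def scaleR_diff_left sum_subtractf)

lemma GDERIV_Lag:
  assumes "GDERIV f w :> gradient f w" "\<And>i. GDERIV (\<lambda>u. g u $ i) w :> gradient (\<lambda>u. g u $ i) w"
  shows "GDERIV (\<lambda>(x, y). Lag f g x y z) w :> lag_gradient f g z w"
proof -
  have "(\<lambda>(x, y). Lag f g x y z) = (\<lambda>u. f u + (\<Sum>i\<in>UNIV. z $ i * g u $ i))"
    by (auto simp: Lag_def inner_vec_def)
  then show ?thesis
    unfolding lag_gradient_def jacobian_T_def
    by (simp add: GDERIV_add[OF assms(1) GDERIV_sum_scaleR[OF assms(2)]])
qed

text \<open>Writing \<open>l = z + (l - z)\<close> exhibits a difference of Lagrangian gradients in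
  the \<open>x\<close>-row; \<open>opt\<close> turns the term
  \<open>(1 / \<gamma>1) *\<^sub>R (y - \<theta>)\<close> of the \<open>y\<close>-row into the
  missing half of the same difference.\<close>

lemma gap_gradient_eq:
  fixes f :: "(real^'n) \<times> (real^'m) \<Rightarrow> real" and g :: "(real^'n) \<times> (real^'m) \<Rightarrow> real^'q"
    and x :: "real^'n" and y :: "real^'m" and z :: "real^'q" and \<gamma>1 \<gamma>2 :: real
  defines "\<theta> \<equiv> theta_star f g \<gamma>1 x y z" and "l \<equiv> lambda_star g \<gamma>2 x y z"
  assumes f: "GDERIV f (x, y) :> gradient f (x, y)" "GDERIV f (x, \<theta>) :> gradient f (x, \<theta>)"
    and g: "\<And>i. GDERIV (\<lambda>u. g u $ i) (x, y) :> gradient (\<lambda>u. g u $ i) (x, y)"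
      "\<And>i. GDERIV (\<lambda>u. g u $ i) (x, \<theta>) :> gradient (\<lambda>u. g u $ i) (x, \<theta>)"
    and opt: "snd (lag_gradient f g z (x, \<theta>)) = (1 / \<gamma>1) *\<^sub>R (y - \<theta>)"
  shows "fst (gap_gradient f g \<gamma>1 \<gamma>2 x y z)
      = lag_gradient f g z (x, y) - lag_gradient f g z (x, \<theta>) + jacobian_T g (x, y) (l - z)"
    and "snd (gap_gradient f g \<gamma>1 \<gamma>2 x y z) = (1 / \<gamma>2) *\<^sub>R (l - z) - g (x, \<theta>)"
proof -
  note grads = gradient_eqI[OF GDERIV_fst[OF f(1)]] gradient_eqI[OF GDERIV_fst[OF f(2)]]
    gradient_eqI[OF GDERIV_snd[OF f(1)]] gradient_eqI[OF GDERIV_fst[OF g(1)]]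
    gradient_eqI[OF GDERIV_fst[OF g(2)]] gradient_eqI[OF GDERIV_snd[OF g(1)]]
  have jac: "jacobian_T (\<lambda>x. g (x, y)) x c = fst (jacobian_T g (x, y) c)"
    "jacobian_T (\<lambda>x. g (x, \<theta>)) x c = fst (jacobian_T g (x, \<theta>) c)"
    "jacobian_T (\<lambda>y. g (x, y)) y c = snd (jacobian_T g (x, y) c)" for c
    by (simp_all add: jacobian_T_def grads fst_sum snd_sum)
  show "fst (gap_gradient f g \<gamma>1 \<gamma>2 x y z)
      = lag_gradient f g z (x, y) - lag_gradient f g z (x, \<theta>) + jacobian_T g (x, y) (l - z)"
  proof (rule prod_eqI)
    show "fst (fst (gap_gradient f g \<gamma>1 \<gamma>2 x y z))
      = fst (lag_gradient f g z (x, y) - lag_gradient f g z (x, \<theta>) + jacobian_T g (x, y) (l - z))"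
      by (simp add: gap_gradient_def Let_def \<theta>_def[symmetric] l_def[symmetric] grads jac
          lag_gradient_def jacobian_T_diff)
    show "snd (fst (gap_gradient f g \<gamma>1 \<gamma>2 x y z))
      = snd (lag_gradient f g z (x, y) - lag_gradient f g z (x, \<theta>) + jacobian_T g (x, y) (l - z))"
      unfolding snd_add snd_diff opt
      by (simp add: gap_gradient_def Let_def \<theta>_def[symmetric] l_def[symmetric] grads jac
          lag_gradient_def jacobian_T_diff)
  qed
  show "snd (gap_gradient f g \<gamma>1 \<gamma>2 x y z) = (1 / \<gamma>2) *\<^sub>R (l - z) - g (x, \<theta>)"
    by (simp add: gap_gradient_def Let_def \<theta>_def[symmetric] l_def[symmetric] flip: scaleR_minus_right)
qed

lemma gradient_penalty:
  fixes g :: "(real^'n) \<times> (real^'m) \<Rightarrow> real^'q" and z s :: "real^'q"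
  assumes g: "\<And>i. GDERIV (\<lambda>u. g u $ i) (x, y) :> gradient (\<lambda>u. g u $ i) (x, y)"
  shows "gradient (\<lambda>((x, y), (z, s)). (norm (g (x, y) + s))\<^sup>2) ((x, y), (z, s))
    = (2 *\<^sub>R jacobian_T g (x, y) (g (x, y) + s), (0, 2 *\<^sub>R (g (x, y) + s)))"
proof (rule gradient_eqI)
  let ?p = "((x, y), (z, s))"
  let ?h = "\<lambda>i p. g (fst p) $ i + snd (snd p) $ i"
  have h: "(?h i has_derivative
      (\<lambda>v. v \<bullet> (gradient (\<lambda>u. g u $ i) (x, y), (0, axis i 1)))) (at ?p)" for i
  proof -
    have 1: "((\<lambda>p. g (fst p) $ i) has_derivative (\<lambda>v. fst v \<bullet> gradient (\<lambda>u. g u $ i) (x, y))) (at ?p)"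
      by (rule has_derivative_compose[where f = fst and g = "\<lambda>u. g u $ i"])
        (use g[of i] in \<open>auto simp: gderiv_def intro!: derivative_eq_intros\<close>)
    have 2: "((\<lambda>p. snd (snd p) $ i) has_derivative (\<lambda>v. snd (snd v) $ i)) (at ?p)"
      by (auto intro!: derivative_eq_intros bounded_linear.has_derivative[OF bounded_linear_vec_nth])
    show ?thesis
      using has_derivative_add[OF 1 2] by (simp add: inner_prod_def inner_axis)
  qed
  have sq: "GDERIV (\<lambda>p. (?h i p)\<^sup>2) ?p :>
      (2 * (g (x, y) $ i + s $ i)) *\<^sub>R (gradient (\<lambda>u. g u $ i) (x, y), (0, axis i 1))" for i
    unfolding gderiv_def
    by (rule has_derivative_eq_rhs[OF has_derivative_power[OF h[of i], of 2]]) (auto simp: fun_eq_iff algebra_simps)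
  have "GDERIV (\<lambda>p. \<Sum>i\<in>UNIV. 1 * (?h i p)\<^sup>2) ?p :> (\<Sum>i\<in>UNIV. 1 *\<^sub>R
      (2 * (g (x, y) $ i + s $ i)) *\<^sub>R (gradient (\<lambda>u. g u $ i) (x, y), (0, axis i 1)))"
    by (rule GDERIV_sum_scaleR[OF sq])
  moreover have "(\<lambda>p :: ((real^'n) \<times> (real^'m)) \<times> ((real^'q) \<times> (real^'q)). \<Sum>i\<in>UNIV. 1 * (?h i p)\<^sup>2) = (\<lambda>((x, y), (z, s)). (norm (g (x, y) + s))\<^sup>2)"
    unfolding power2_norm_eq_inner by (auto simp: fun_eq_iff inner_vec_def power2_eq_square)
  moreover have "(\<Sum>i\<in>UNIV. 1 *\<^sub>R
      (2 * (g (x, y) $ i + s $ i)) *\<^sub>R (gradient (\<lambda>u. g u $ i) (x, y), (0::real^'q, axis i 1)))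
      = (2 *\<^sub>R jacobian_T g (x, y) (g (x, y) + s), (0, 2 *\<^sub>R (g (x, y) + s)))"
    by (intro prod_eqI)
      (simp_all add: fst_sum snd_sum jacobian_T_def scaleR_sum_right vec_eq_iff axis_def
        if_distrib[of "\<lambda>r. _ * r"] sum.delta cong: if_cong)
  ultimately show "GDERIV (\<lambda>((x, y), (z, s)). (norm (g (x, y) + s))\<^sup>2) ?p :>
      (2 *\<^sub>R jacobian_T g (x, y) (g (x, y) + s), (0, 2 *\<^sub>R (g (x, y) + s)))"
    by (simp only:)
qed

text \<open>One component of the \<open>(z, s)\<close>-part of the stationarity inclusion. The error bound \<open>\<delta>\<close> is linear
  in \<open>\<eta>\<close> with a factor \<open>\<kappa>\<close>, so it survives a rescaling of the multipliers and vanishes with \<open>\<kappa>\<close>; this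
  is where the second penalty parameter has to dominate the first.\<close>

lemma approximate_complementarity_multipliers:
  fixes z s c r1 r2 \<gamma> \<epsilon>z \<epsilon>s \<zeta> \<xi> \<beta> \<eta> :: real
  assumes pos: "r1 > 0" "r2 > 0" "\<gamma> > 0" and zs: "z \<ge> 0" "s \<ge> 0" "z * s = 0"
    and normal: "z > 0 \<Longrightarrow> \<zeta> = 0" "s > 0 \<Longrightarrow> \<xi> = 0" "\<zeta> \<le> 0 \<and> \<xi> \<le> 0 \<or> \<zeta> * \<xi> = 0"
    and \<epsilon>z: "\<epsilon>z = r1 * max (- z / \<gamma> - c) 0 + \<beta> + \<zeta>"
    and \<epsilon>s: "\<epsilon>s = 2 * r2 * (c + s) + \<xi>"
    and \<eta>: "\<eta> = r1 * max (- z) (\<gamma> * c) + 2 * r2 * (c + s)"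
  defines "\<kappa> \<equiv> r1 / (2 * r2)"
  defines "\<delta> \<equiv> (1 + \<gamma> * \<kappa>) * (\<bar>\<epsilon>z\<bar> + \<bar>\<epsilon>s\<bar>) + (1 + \<gamma>) * \<kappa> * \<bar>\<eta>\<bar>"
  obtains a b where "0 \<le> a \<and> 0 \<le> b \<or> a * b = 0" "z > 0 \<longrightarrow> b = 0" "s > 0 \<longrightarrow> a = 0"
    "\<bar>\<eta> - a\<bar> \<le> \<delta>" "\<bar>\<beta> - b\<bar> \<le> \<delta>"
proof -
  have \<kappa>: "\<kappa> > 0" using pos by (simp add: \<kappa>_def)
  have \<delta>: "\<delta> = \<bar>\<epsilon>z\<bar> + \<bar>\<epsilon>s\<bar> + \<gamma> * \<kappa> * \<bar>\<epsilon>z\<bar> + \<gamma> * \<kappa> * \<bar>\<epsilon>s\<bar> + \<kappa> * \<bar>\<eta>\<bar> + \<gamma> * (\<kappa> * \<bar>\<eta>\<bar>)"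
    by (simp add: \<delta>_def algebra_simps)
  have nonneg: "0 \<le> \<gamma> * \<kappa> * \<bar>\<epsilon>z\<bar>" "0 \<le> \<gamma> * \<kappa> * \<bar>\<epsilon>s\<bar>" "0 \<le> \<kappa> * \<bar>\<eta>\<bar>" "0 \<le> \<gamma> * (\<kappa> * \<bar>\<eta>\<bar>)"
    using pos \<kappa> by auto
  have r1: "r1 = \<kappa> * (2 * r2)" using pos by (simp add: \<kappa>_def)
  \<comment> \<open>The unwanted term \<open>r1 * \<bar>c\<bar>\<close> is \<open>\<kappa>\<close>
    times \<open>2 * r2 * \<bar>c\<bar>\<close>, hence harmless whenever the latter is visible in
    \<open>\<eta>\<close>.\<close>
  have ratio: "r1 * \<bar>c\<bar> \<le> \<kappa> * \<bar>\<eta>\<bar>" if "2 * r2 * \<bar>c\<bar> \<le> \<bar>\<eta>\<bar>"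
    using mult_left_mono[OF that, of \<kappa>] \<kappa> by (simp add: r1 mult_ac)
  consider (z) "z > 0" "s = 0" | (s) "z = 0" "s > 0" | (both) "z = 0" "s = 0"
    using zs by (metis less_le mult_eq_0_iff)
  then show ?thesis
  proof cases
    \<comment> \<open>Witnesses \<open>\<eta>\<close> and 0. If the maximum in
      \<open>\<epsilon>z\<close> is positive, then \<open>c < 0\<close> and both summands of
      \<open>\<eta>\<close> are negative, so no cancellation hides
      \<open>2 * r2 * c\<close>.\<close>
    case z
    have "\<bar>\<beta>\<bar> \<le> \<delta>"
    proof (cases "- z / \<gamma> - c > 0")
      case True
      have "z / \<gamma> > 0" using z pos by simp
      then have c: "c < 0" using True by linarith
      have "\<gamma> * c < - z" using True pos by (simp add: field_simps)
      then have "\<eta> = - (r1 * z) + 2 * r2 * c"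
        using z by (simp add: \<eta>)
      moreover have "r1 * z > 0" "2 * r2 * c < 0"
        using pos z c by (auto simp: mult_pos_neg)
      ultimately have "2 * r2 * \<bar>c\<bar> \<le> \<bar>\<eta>\<bar>"
        using c pos by simp
      then have *: "r1 * \<bar>c\<bar> \<le> \<kappa> * \<bar>\<eta>\<bar>" by (rule ratio)
      have "r1 * (- z / \<gamma> - c) \<le> r1 * \<bar>c\<bar>"
        using c pos \<open>z / \<gamma> > 0\<close> by (intro mult_left_mono) auto
      moreover have "0 \<le> r1 * (- z / \<gamma> - c)"
        using pos True by simp
      ultimately have "\<bar>\<epsilon>z - \<beta>\<bar> \<le> r1 * \<bar>c\<bar>"
        using \<epsilon>z normal(1)[OF z(1)] True by (simp add: max_def)
      then show ?thesis
        using * nonneg unfolding \<delta> by linarith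
    next
      case False
      then show ?thesis
        using \<epsilon>z normal(1)[OF z(1)] nonneg unfolding \<delta> by auto
    qed
    then show ?thesis
      using that[of \<eta> 0] z nonneg unfolding \<delta> by auto
  next
    \<comment> \<open>Witnesses 0 and \<open>\<beta>\<close>. Now \<open>\<xi> = 0\<close>, so
      \<open>\<epsilon>s\<close> itself bounds \<open>2 * r2 * c\<close> for positive
      \<open>c\<close>; this is the origin of the term with \<open>\<gamma> * \<kappa>\<close> and
      \<open>\<epsilon>s\<close> in \<open>\<delta>\<close>.\<close>
    case s
    have \<epsilon>s': "\<epsilon>s = 2 * r2 * (c + s)" using \<epsilon>s normal(2)[OF s(2)] by simp
    have "r1 * max 0 (\<gamma> * c) \<le> \<gamma> * \<kappa> * \<bar>\<epsilon>s\<bar>"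
    proof (cases "c > 0")
      case True
      have "2 * r2 * c \<le> \<epsilon>s"
        unfolding \<epsilon>s' using s pos by (intro mult_left_mono) auto
      then have "\<gamma> * \<kappa> * (2 * r2 * c) \<le> \<gamma> * \<kappa> * \<bar>\<epsilon>s\<bar>"
        using pos \<kappa> by (intro mult_left_mono) auto
      moreover have "r1 * max 0 (\<gamma> * c) = \<gamma> * \<kappa> * (2 * r2 * c)"
        using True pos by (simp add: r1 max_def zero_le_mult_iff)
      ultimately show ?thesis by linarith
    next
      case False
      then have "max 0 (\<gamma> * c) = 0" using pos by (simp add: max_def zero_le_mult_iff)
      then show ?thesis using nonneg by simp
    qed
    moreover have "0 \<le> r1 * max 0 (\<gamma> * c)" using pos by simp
    moreover have "\<eta> = r1 * max 0 (\<gamma> * c) + \<epsilon>s" using s by (simp add: \<eta> \<epsilon>s')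
    ultimately have "\<bar>\<eta>\<bar> \<le> \<delta>"
      using nonneg unfolding \<delta> by linarith
    then show ?thesis
      using that[of 0 \<beta>] s nonneg unfolding \<delta> by auto
  next
    \<comment> \<open>Witnesses \<open>- \<xi>\<close> and \<open>- \<zeta>\<close>: the negated
      normals have the sign structure exactly. The summands of \<open>\<eta>\<close> never have
      opposite signs, so \<open>2 * r2 * \<bar>c\<bar>\<close> is visible again.\<close>
    case both
    have \<eta>': "\<eta> = r1 * max 0 (\<gamma> * c) + 2 * r2 * c" using both by (simp add: \<eta>)
    have "2 * r2 * \<bar>c\<bar> \<le> \<bar>\<eta>\<bar>"
    proof (cases "c > 0")
      case True
      then have "0 \<le> r1 * max 0 (\<gamma> * c)" "0 \<le> 2 * r2 * c" using pos by auto
      then show ?thesis using True by (simp add: \<eta>')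
    next
      case False
      then have "max 0 (\<gamma> * c) = 0" using pos by (simp add: max_def zero_le_mult_iff)
      then show ?thesis using pos by (simp add: \<eta>' abs_mult)
    qed
    then have *: "r1 * \<bar>c\<bar> \<le> \<kappa> * \<bar>\<eta>\<bar>" by (rule ratio)
    have "r1 * max 0 (\<gamma> * c) \<le> r1 * (\<gamma> * \<bar>c\<bar>)"
      using pos by (intro mult_left_mono) (auto simp: max_def)
    also have "\<dots> \<le> \<gamma> * (\<kappa> * \<bar>\<eta>\<bar>)"
      using mult_left_mono[OF *, of \<gamma>] pos by (simp add: mult_ac)
    finally have 1: "r1 * max 0 (\<gamma> * c) \<le> \<gamma> * (\<kappa> * \<bar>\<eta>\<bar>)" .
    have "r1 * max (- c) 0 \<le> r1 * \<bar>c\<bar>"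
      using pos by (intro mult_left_mono) auto
    then have 2: "r1 * max (- c) 0 \<le> \<kappa> * \<bar>\<eta>\<bar>" using * by linarith
    have 3: "0 \<le> r1 * max 0 (\<gamma> * c)" "0 \<le> r1 * max (- c) 0" using pos by auto
    have "\<eta> + \<xi> = r1 * max 0 (\<gamma> * c) + \<epsilon>s" "\<beta> + \<zeta> = \<epsilon>z - r1 * max (- c) 0"
      using both by (simp_all add: \<eta>' \<epsilon>s \<epsilon>z)
    then have "\<bar>\<eta> - (- \<xi>)\<bar> \<le> \<delta>" "\<bar>\<beta> - (- \<zeta>)\<bar> \<le> \<delta>"
      using 1 2 3 nonneg unfolding \<delta> by linarith+
    then show ?thesis
      using that[of "- \<xi>" "- \<zeta>"] both normal(3) by auto
  qed
qed

section \<open>Derivative and symmetry of the Lagrangian Hessian, and its role in MPCC-MFCQ\<close>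

lemma linear_lag_hessian:
  fixes f :: "'a::euclidean_space \<Rightarrow> real"
  assumes "C2_on U f" "\<And>i. C2_on U (\<lambda>w. g w $ i)" "w \<in> U"
  shows "linear (lag_hessian f g z w)"
proof -
  have "linear (frechet_derivative (gradient f) (at w))"
    "linear (frechet_derivative (gradient (\<lambda>u. g u $ i)) (at w))" for i
    using assms by (auto simp: C2_on_def C1_on_def intro!: linear_frechet_derivative)
  then show ?thesis
    unfolding lag_hessian_def[abs_def]
    by (intro linear_compose_add linear_compose_sum linear_compose_scale_right ballI)
qed

text \<open>Joint differentiation is needed because MPCC-MFCQ treats \<open>z\<close> as a variable;
  the product rule contributes the Jacobian term.\<close>

lemma has_derivative_lag_gradient:
  fixes f :: "'a::euclidean_space \<Rightarrow> real"
  assumes "C2_on U f" "\<And>i. C2_on U (\<lambda>w. g w $ i)" "w \<in> U"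
  shows "((\<lambda>(w, z). lag_gradient f g z w) has_derivative
    (\<lambda>(v, \<zeta>). lag_hessian f g z w v + jacobian_T g w \<zeta>)) (at (w, z))"
proof -
  have f: "((\<lambda>p. gradient f (fst p)) has_derivative
      (\<lambda>v. frechet_derivative (gradient f) (at w) (fst v))) (at (w, z))"
    by (rule has_derivative_compose[where f = fst and g = "gradient f"])
      (use assms in \<open>auto simp: C2_on_def C1_on_def frechet_derivative_works[symmetric]
        intro!: derivative_eq_intros\<close>)
  have g: "((\<lambda>p. gradient (\<lambda>u. g u $ i) (fst p)) has_derivative
      (\<lambda>v. frechet_derivative (gradient (\<lambda>u. g u $ i)) (at w) (fst v))) (at (w, z))" for i
    by (rule has_derivative_compose[where f = fst and g = "gradient (\<lambda>u. g u $ i)"])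
      (use assms in \<open>auto simp: C2_on_def C1_on_def frechet_derivative_works[symmetric]
        intro!: derivative_eq_intros\<close>)
  have n: "((\<lambda>p. snd p $ i) has_derivative (\<lambda>v. snd v $ i)) (at (w, z))" for i
    by (auto intro!: derivative_eq_intros bounded_linear.has_derivative[OF bounded_linear_vec_nth])
  have "((\<lambda>p. gradient f (fst p) + (\<Sum>i\<in>UNIV. snd p $ i *\<^sub>R gradient (\<lambda>u. g u $ i) (fst p)))
     has_derivative (\<lambda>v. frechet_derivative (gradient f) (at w) (fst v)
        + (\<Sum>i\<in>UNIV. z $ i *\<^sub>R frechet_derivative (gradient (\<lambda>u. g u $ i)) (at w) (fst v)
             + snd v $ i *\<^sub>R gradient (\<lambda>u. g u $ i) w))) (at (w, z))"
    using has_derivative_add[OF f has_derivative_sum[OF has_derivative_scaleR[OF n g]]] by simp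
  then show ?thesis
    by (simp add: lag_gradient_def lag_hessian_def jacobian_T_def case_prod_unfold sum.distrib add.assoc)
qed

lemma lag_hessian_symmetric:
  assumes "open U" "C2_on U f" "\<And>i. C2_on U (\<lambda>w. g w $ i)" "w \<in> U"
  shows "lag_hessian f g z w u \<bullet> v = lag_hessian f g z w v \<bullet> u"
  using Hessian_symmetric[OF assms(1,2,4), of u v] Hessian_symmetric[OF assms(1,3,4), of _ u v]
  by (simp add: lag_hessian_def inner_add_left inner_sum_left)

text \<open>The multiplier of the constraint \<open>z\<^sub>i = 0\<close> is \<open>- \<nabla>\<^sub>yg\<^sub>i \<bullet> \<omega>\<close>, which kills the \<open>z\<close>-component of the
  gradient combination.\<close>

lemma MPCC_MFCQ_multipliers_zero:
  fixes f :: "(real^'n) \<times> (real^'m) \<Rightarrow> real" and G :: "(real^'n) \<times> (real^'m) \<Rightarrow> real^'p"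
    and g :: "(real^'n) \<times> (real^'m) \<Rightarrow> real^'q" and x :: "real^'n" and y :: "real^'m"
  assumes mfcq: "MPCC_MFCQ f G g x y z"
    and U: "open U" "C2_on U f" "\<And>i. C2_on U (\<lambda>w. g w $ i)" "(x, y) \<in> U"
    and G: "\<And>j. GDERIV (\<lambda>w. G w $ j) (x, y) :> gradient (\<lambda>w. G w $ j) (x, y)"
    and feas: "0 \<le> z" "g (x, y) \<le> 0" "\<And>i. z $ i * g (x, y) $ i = 0"
    and \<mu>: "0 \<le> \<mu>" "\<And>j. \<mu> $ j * G (x, y) $ j = 0"
    and \<eta>: "\<And>i. i \<in> I_zero_plus g x y z \<Longrightarrow> \<eta> $ i = 0"
    and \<omega>: "\<And>i. i \<in> I_plus_zero g x y z \<Longrightarrow> snd (gradient (\<lambda>w. g w $ i) (x, y)) \<bullet> \<omega> = 0"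
    and eq: "jacobian_T G (x, y) \<mu> + lag_hessian f g z (x, y) (0, \<omega>) + jacobian_T g (x, y) \<eta> = 0"
  shows "\<omega> = 0 \<and> \<eta> = 0"
proof -
  let ?p = "((x, y), z)"
  let ?Ip = "I_plus_zero g x y z" and ?Iz = "I_zero_plus g x y z" and ?Ib = "I_zero_zero g x y z"
  let ?dg = "\<lambda>i. gradient (\<lambda>w. g w $ i) (x, y)"
  let ?H = "lag_hessian f g z (x, y)"
  have f_G: "GDERIV f w :> gradient f w" and g_G: "GDERIV (\<lambda>w. g w $ i) w :> gradient (\<lambda>w. g w $ i) w"
    if "w \<in> U" for w i
    using U that by (auto simp: C2_on_def intro: C1_on_GDERIV)
  have lin: "linear ?H"
    using linear_lag_hessian[OF U(2-4)] .
  have grad_fst: "gradient (\<lambda>((x, y), z :: real^'q). h (x, y)) ?p = (gradient h (x, y), 0)"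
    if "GDERIV h (x, y) :> gradient h (x, y)" for h :: "(real^'n) \<times> (real^'m) \<Rightarrow> real"
  proof (rule gradient_eqI)
    have "((\<lambda>p::((real^'n) \<times> (real^'m)) \<times> (real^'q). h (fst p)) has_derivative
        (\<lambda>v. fst v \<bullet> gradient h (x, y))) (at ?p)"
      by (rule has_derivative_compose[where f = fst and g = h])
        (use that in \<open>auto simp: gderiv_def intro!: derivative_eq_intros\<close>)
    then show "GDERIV (\<lambda>((x, y), z :: real^'q). h (x, y)) ?p :> (gradient h (x, y), 0)"
      by (simp add: gderiv_def case_prod_unfold inner_prod_def)
  qed
  have grad_z: "gradient (\<lambda>((x :: real^'n, y :: real^'m), z). z $ i) ?p = (0, axis i 1)" for i
  proof (rule gradient_eqI)
    have "((\<lambda>p::((real^'n) \<times> (real^'m)) \<times> (real^'q). snd p $ i) has_derivative (\<lambda>v. snd v $ i)) (at ?p)"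
      by (auto intro!: derivative_eq_intros bounded_linear.has_derivative[OF bounded_linear_vec_nth])
    then show "GDERIV (\<lambda>((x :: real^'n, y :: real^'m), z). z $ i) ?p :> (0, axis i 1)"
      by (simp add: gderiv_def case_prod_unfold inner_prod_def inner_axis)
  qed
  have grad_lag: "gradient (\<lambda>((x, y), z). gradient (\<lambda>y. Lag f g x y z) y $ j) ?p
      = (?H (0, axis j 1), \<chi> i. snd (?dg i) $ j)" for j
  proof (rule gradient_eqI)
    have "((\<lambda>p. snd (lag_gradient f g (snd p) (fst p)) $ j) has_derivative
        (\<lambda>v. snd (?H (fst v) + jacobian_T g (x, y) (snd v)) $ j)) (at ?p)"
      using has_derivative_lag_gradient[OF U(2-4), of z]
      by (intro bounded_linear.has_derivative[OF bounded_linear_vec_nth]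
          bounded_linear.has_derivative[OF bounded_linear_snd]) (simp add: case_prod_unfold)
    moreover have "(\<lambda>v. snd (?H (fst v) + jacobian_T g (x, y) (snd v)) $ j)
        = (\<lambda>v. v \<bullet> (?H (0, axis j 1), \<chi> i. snd (?dg i) $ j))"
    proof
      fix v :: "((real^'n) \<times> (real^'m)) \<times> (real^'q)"
      \<comment> \<open>A component of the \<open>y\<close>-gradient has a row of the Hessian as its
        gradient. Symmetry turns it into the Hessian applied to a basis vector, so the rows weighted
        by \<open>\<omega>\<close> add up to \<open>?H (0, \<omega>)\<close>.\<close>
      have "fst v \<bullet> ?H (0, axis j 1) = snd (?H (fst v)) $ j"
        using lag_hessian_symmetric[OF U, of z "fst v" "(0, axis j 1)"]
        by (simp add: inner_prod_def inner_axis inner_axis' inner_commute)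
      moreover have "snd (jacobian_T g (x, y) (snd v)) $ j = snd v \<bullet> (\<chi> i. snd (?dg i) $ j)"
        by (simp add: jacobian_T_def snd_sum inner_vec_def)
      ultimately show "snd (?H (fst v) + jacobian_T g (x, y) (snd v)) $ j
          = v \<bullet> (?H (0, axis j 1), \<chi> i. snd (?dg i) $ j)"
        by (simp add: inner_prod_def[of v])
    qed
    ultimately have der: "((\<lambda>p. snd (lag_gradient f g (snd p) (fst p)) $ j) has_derivative
        (\<lambda>v. v \<bullet> (?H (0, axis j 1), \<chi> i. snd (?dg i) $ j))) (at ?p)"
      by (simp only:)
    show "GDERIV (\<lambda>((x, y), z). gradient (\<lambda>y. Lag f g x y z) y $ j) ?p :>
        (?H (0, axis j 1), \<chi> i. snd (?dg i) $ j)"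
      unfolding gderiv_def
    \<comment> \<open>The \<open>y\<close>-gradient is known to agree with the explicit formula only
      on \<open>U\<close>, which suffices as \<open>U\<close> is open.\<close>
    proof (rule has_derivative_transform_within_open[OF der])
      show "open (U \<times> (UNIV :: (real^'q) set))" "?p \<in> U \<times> UNIV"
        using U by (auto simp: open_Times)
      fix p assume "p \<in> U \<times> (UNIV :: (real^'q) set)"
      then obtain a b c where p: "p = ((a, b), c)" "(a, b) \<in> U"
        by (cases p) auto
      have "GDERIV (\<lambda>y. Lag f g a y c) b :> snd (lag_gradient f g c (a, b))"
        using GDERIV_snd[OF GDERIV_Lag[OF f_G[OF p(2)] g_G[OF p(2)]]] by simp
      then show "snd (lag_gradient f g (snd p) (fst p)) $ j
          = (\<lambda>((x, y), z). gradient (\<lambda>y. Lag f g x y z) y $ j) p"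
        by (simp add: p gradient_eqI)
    qed
  qed
  have grad_neg: "gradient (\<lambda>((x, y), z :: real^'q). - g (x, y) $ i) ?p = (- ?dg i, 0)" for i
  proof -
    have "GDERIV (\<lambda>w. - g w $ i) (x, y) :> - ?dg i"
      by (rule GDERIV_minus[OF g_G[OF U(4)]])
    then show ?thesis
      using grad_fst[of "\<lambda>w. - g w $ i"] gradient_eqI by (metis (no_types, lifting))
  qed
  define \<tau> where "\<tau> i = - (snd (?dg i) \<bullet> \<omega>)" for i
  define h where "h = case_sum (\<lambda>j ((x, y), z). gradient (\<lambda>y. Lag f g x y z) y $ j)
         (case_sum (\<lambda>i ((x, y), z). - g (x, y) $ i) (\<lambda>i ((x :: real^'n, y :: real^'m), z :: real^'q). z $ i))"
  define c where "c = case_sum (\<lambda>j ((x, y), z). G (x, y) $ j)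
         (case_sum (\<lambda>i ((x, y), z). g (x, y) $ i) (\<lambda>i ((x :: real^'n, y :: real^'m), z :: real^'q). - z $ i))"
  \<comment> \<open>The sign on \<open>\<eta>\<close> compensates that the system is stated with
    \<open>- g\<close>.\<close>
  define m where "m = case_sum (\<lambda>j. \<omega> $ j) (case_sum (\<lambda>i. - \<eta> $ i) \<tau>)"
  define n where "n = case_sum (\<lambda>j. \<mu> $ j) (\<lambda>_ :: 'q + 'q. 0 :: real)"
  let ?I = "(UNIV :: 'm set) <+> ((?Ip \<union> ?Ib) <+> (?Iz \<union> ?Ib))"
  let ?J = "(UNIV :: 'p set) <+> (?Iz <+> ?Ip)"
  let ?A = "{j \<in> ?J. c j ?p = 0}"
  have classes: "i \<in> ?Ip \<union> ?Ib \<longleftrightarrow> i \<notin> ?Iz" "i \<in> ?Iz \<union> ?Ib \<longleftrightarrow> i \<notin> ?Ip" for i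
    using feas(1,2) feas(3)[of i] unfolding less_eq_vec_def
    by (auto simp: I_plus_zero_def I_zero_plus_def I_zero_zero_def less_le)
  \<comment> \<open>The inequalities attached to \<open>?Iz\<close> and \<open>?Ip\<close> are
    strict by the definition of these sets, so only components of \<open>G\<close> can be
    active.\<close>
  have A: "?A = Inl ` {j. G (x, y) $ j = 0}"
    by (auto simp: c_def I_zero_plus_def I_plus_zero_def)
  have sum_h: "(\<Sum>i\<in>?I. m i *\<^sub>R gradient (h i) ?p)
      = (?H (0, \<omega>) + jacobian_T g (x, y) \<eta>, 0)"
  proof -
    have "(\<Sum>j\<in>UNIV. \<omega> $ j *\<^sub>R ?H (0, axis j 1)) = ?H (\<Sum>j\<in>UNIV. \<omega> $ j *\<^sub>R (0, axis j 1))"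
      by (simp add: linear_sum[OF lin] linear_cmul[OF lin] del: scaleR_Pair)
    also have "(\<Sum>j\<in>UNIV. \<omega> $ j *\<^sub>R (0 :: real^'n, axis j 1)) = (0, \<omega>)"
      by (intro prod_eqI) (simp_all add: fst_sum snd_sum vec_eq_iff axis_def
          if_distrib[of "\<lambda>r. _ * r"] sum.delta cong: if_cong)
    finally have 1: "(\<Sum>j\<in>UNIV. \<omega> $ j *\<^sub>R (?H (0, axis j 1), \<chi> i. snd (?dg i) $ j))
        = (?H (0, \<omega>), \<chi> i. snd (?dg i) \<bullet> \<omega>)"
      by (intro prod_eqI) (simp_all add: fst_sum snd_sum vec_eq_iff inner_vec_def mult.commute)
    have "(\<Sum>i\<in>?Ip \<union> ?Ib. \<eta> $ i *\<^sub>R ?dg i) = jacobian_T g (x, y) \<eta>"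
      unfolding jacobian_T_def using classes(1) \<eta> by (intro sum.mono_neutral_left) auto
    then have 2: "(\<Sum>i\<in>?Ip \<union> ?Ib. - \<eta> $ i *\<^sub>R (- ?dg i, 0 :: real^'q)) = (jacobian_T g (x, y) \<eta>, 0)"
      by (intro prod_eqI) (simp_all add: fst_sum snd_sum)
    have "(\<Sum>i\<in>?Iz \<union> ?Ib. \<tau> i *\<^sub>R axis i 1) = (\<Sum>i\<in>UNIV. \<tau> i *\<^sub>R (axis i 1 :: real^'q))"
      using classes(2) \<omega> by (intro sum.mono_neutral_left) (auto simp: \<tau>_def)
    also have "\<dots> = (\<chi> i. \<tau> i)"
      by (simp add: vec_eq_iff axis_def if_distrib[of "\<lambda>r. _ * r"] sum.delta cong: if_cong)
    finally have 3: "(\<Sum>i\<in>?Iz \<union> ?Ib. \<tau> i *\<^sub>R (0 :: (real^'n) \<times> (real^'m), axis i 1 :: real^'q)) = (0, \<chi> i. \<tau> i)"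
      by (intro prod_eqI) (simp_all add: fst_sum snd_sum)
    have "(\<Sum>i\<in>?I. m i *\<^sub>R gradient (h i) ?p)
        = (?H (0, \<omega>), \<chi> i. snd (?dg i) \<bullet> \<omega>) + ((jacobian_T g (x, y) \<eta>, 0) + (0, \<chi> i. \<tau> i))"
      by (simp add: sum.Plus h_def m_def grad_lag grad_neg grad_z 1[symmetric] 2[symmetric] 3[symmetric]
          del: scaleR_Pair)
    then show ?thesis
      by (simp add: vec_eq_iff \<tau>_def)
  qed
  have sum_c: "(\<Sum>j\<in>?A. n j *\<^sub>R gradient (c j) ?p) = (jacobian_T G (x, y) \<mu>, 0)"
  proof -
    have "(\<Sum>j\<in>?A. n j *\<^sub>R gradient (c j) ?p)
        = (\<Sum>j | G (x, y) $ j = 0. \<mu> $ j *\<^sub>R (gradient (\<lambda>w. G w $ j) (x, y), 0))"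
      unfolding A by (simp add: sum.reindex n_def c_def grad_fst[OF G])
    also have "\<dots> = (\<Sum>j\<in>UNIV. \<mu> $ j *\<^sub>R (gradient (\<lambda>w. G w $ j) (x, y), 0))"
    proof (rule sum.mono_neutral_left)
      have "\<mu> $ i = 0" if "G (x, y) $ i \<noteq> 0" for i
        using \<mu>(2)[of i] that by simp
      then show "\<forall>i\<in>UNIV - {j. G (x, y) $ j = 0}.
          \<mu> $ i *\<^sub>R (gradient (\<lambda>w. G w $ i) (x, y), 0 :: real^'q) = 0"
        by (simp add: zero_prod_def)
    qed auto
    also have "\<dots> = (jacobian_T G (x, y) \<mu>, 0)"
      by (intro prod_eqI) (simp_all add: fst_sum snd_sum jacobian_T_def)
    finally show ?thesis .
  qed
  have "(\<Sum>i\<in>?I. m i *\<^sub>R gradient (h i) ?p) + (\<Sum>j\<in>?A. n j *\<^sub>R gradient (c j) ?p) = 0"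
    using eq unfolding sum_h sum_c by (simp add: zero_prod_def add_ac)
  moreover have "\<forall>j\<in>?A. 0 \<le> n j"
    using \<mu>(1) unfolding A by (auto simp: n_def less_eq_vec_def)
  ultimately have zero: "\<forall>i\<in>?I. m i = 0"
    using mfcq[unfolded MPCC_MFCQ_def, folded h_def c_def, unfolded MFCQ_def,
        THEN conjunct2, THEN conjunct2, THEN spec, THEN spec, of n m] by blast
  have "\<omega> $ j = 0" for j
    using zero[THEN bspec, OF InlI[OF UNIV_I], of j] by (simp add: m_def)
  moreover have "\<eta> $ i = 0" for i
  proof (cases "i \<in> ?Iz")
    case False
    then have i: "i \<in> ?Ip \<union> ?Ib" using classes(1) by blast
    show ?thesis
      using zero[THEN bspec, OF InrI[OF InlI[OF i]]] by (simp add: m_def)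
  qed (rule \<eta>)
  ultimately show ?thesis
    by (simp add: vec_eq_iff)
qed

section \<open>Limits of approximately stationary points\<close>

lemma tendsto_zero_norm_square:
  assumes "(\<lambda>k. (norm (v k))\<^sup>2) \<longlonglongrightarrow> 0"
  shows "v \<longlonglongrightarrow> 0"
  using tendsto_real_sqrt[OF assms] by (simp add: tendsto_norm_zero_iff)

lemma tendsto_bounded_times_zero:
  fixes X :: "nat \<Rightarrow> 'a::real_normed_vector"
  assumes "bounded (range \<rho>)" "X \<longlonglongrightarrow> 0"
  shows "(\<lambda>k. \<rho> k *\<^sub>R X k) \<longlonglongrightarrow> 0"
proof -
  obtain B where B: "\<And>k. \<bar>\<rho> k\<bar> \<le> B"
    using assms(1) by (auto simp: bounded_iff)
  have "(\<lambda>k. B * norm (X k)) \<longlonglongrightarrow> 0"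
    using tendsto_mult_left[OF tendsto_norm_zero[OF assms(2)], of B] by simp
  then show ?thesis
    by (rule Lim_null_comparison[rotated]) (auto intro!: always_eventually mult_right_mono B)
qed

lemma convex_on_weighted_sum:
  assumes "finite I" "\<And>i. i \<in> I \<Longrightarrow> 0 \<le> c i" "\<And>i. i \<in> I \<Longrightarrow> convex_on UNIV (h i)"
  shows "convex_on UNIV (\<lambda>u. \<Sum>i\<in>I. c i * h i u)"
  using assms
proof (induction I rule: finite_induct)
  case (insert i I)
  then show ?case
    by (simp add: convex_on_add convex_on_cmul)
qed (simp add: convex_on_const)

text \<open>The setting after passing to a subsequence along which \<open>z\<close> converges, with
  the neighbourhoods \<open>U\<close> and \<open>V\<close> fixed as parameters.\<close>

locale approximate_stationary_sequence =
  fixes F f :: "(real^'n) \<times> (real^'m) \<Rightarrow> real"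
    and G :: "(real^'n) \<times> (real^'m) \<Rightarrow> real^'p"
    and g :: "(real^'n) \<times> (real^'m) \<Rightarrow> real^'q"
    and \<gamma>1 \<gamma>2 :: real
    and xbar :: "real^'n" and ybar :: "real^'m" and zbar :: "real^'q"
    and x :: "nat \<Rightarrow> real^'n" and y :: "nat \<Rightarrow> real^'m" and z s :: "nat \<Rightarrow> real^'q"
    and \<epsilon> :: "nat \<Rightarrow> ((real^'n) \<times> (real^'m)) \<times> ((real^'q) \<times> (real^'q))"
    and \<rho>1 \<rho>2 :: "nat \<Rightarrow> real"
    and U V :: "((real^'n) \<times> (real^'m)) set"
  assumes F_C1: "open V" "Omega G \<subseteq> V" "C1_on V F"
    and G_C1_convex: "\<And>j. \<exists>U. open U \<and> Omega G \<subseteq> U \<and>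
          C1_on U (\<lambda>w. G w $ j) \<and> convex_on U (\<lambda>w. G w $ j)"
    and f_convex: "\<And>x. x \<in> Xset G \<Longrightarrow> convex_on UNIV (\<lambda>y. f (x, y))"
    and g_convex: "\<And>x i. x \<in> Xset G \<Longrightarrow> convex_on UNIV (\<lambda>y. g (x, y) $ i)"
    and U: "open U" "Xset G \<times> UNIV \<subseteq> U"
    and f_C2: "C2_on U f" and g_C2: "\<And>i. C2_on U (\<lambda>w. g w $ i)"
    and gamma_pos: "\<gamma>1 > 0" "\<gamma>2 > 0"
    and rho_pos: "\<And>k. \<rho>1 k > 0" "\<And>k. \<rho>2 k > 0"
    and xy_lim: "(\<lambda>k. (x k, y k)) \<longlonglongrightarrow> (xbar, ybar)"
    and z_lim: "z \<longlonglongrightarrow> zbar"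
    and eps_lim: "\<epsilon> \<longlonglongrightarrow> 0"
    and xy_Omega: "\<And>k. (x k, y k) \<in> Omega G"
    and zs_C: "\<And>k. (z k, s k) \<in> Ccompl"
    and gap_lim: "(\<lambda>k. gap f g \<gamma>1 \<gamma>2 (x k) (y k) (z k)) \<longlonglongrightarrow> 0"
    and gs_lim: "(\<lambda>k. g (x k, y k) + s k) \<longlonglongrightarrow> 0"
    and stationary: "\<And>k. \<epsilon> k \<in>
          (+) ((gradient F (x k, y k), (0, 0))
               + \<rho>1 k *\<^sub>R (fst (gap_gradient f g \<gamma>1 \<gamma>2 (x k) (y k) (z k)),
                          (snd (gap_gradient f g \<gamma>1 \<gamma>2 (x k) (y k) (z k)), 0))
               + \<rho>2 k *\<^sub>R gradient (\<lambda>((x, y), (z, s)). (norm (g (x, y) + s))\<^sup>2)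
                            ((x k, y k), (z k, s k)))
          ` (limiting_normal_cone (Omega G) (x k, y k) \<times>
             limiting_normal_cone Ccompl (z k, s k))"
    and MFCQ_upper: "MFCQ_ineq G (xbar, ybar)"
begin

abbreviation "w k \<equiv> (x k, y k)"
abbreviation "wbar \<equiv> (xbar, ybar)"

definition "\<theta> k = theta_star f g \<gamma>1 (x k) (y k) (z k)"
definition "l k = lambda_star g \<gamma>2 (x k) (y k) (z k)"
text \<open>Since \<open>snd (lag_gradient f g z (x, \<theta>)) = (y - \<theta>) / \<gamma>1\<close>, the \<open>(x, y)\<close>-gradient of the gap is
  a difference of \<open>lag_gradient\<close> between \<open>y\<close> and \<open>\<theta>\<close>, plus a \<open>jacobian_T g\<close> term. Multiplied by \<open>\<rho>1\<close>,
  the difference becomes the Hessian applied to \<open>\<omega>\<close>.\<close>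

definition "\<omega> k = \<rho>1 k *\<^sub>R (y k - \<theta> k)"
text \<open>Collects all coefficients of \<open>jacobian_T g\<close>: the shift \<open>l - z\<close>
  comes from the gap, the residual from the quadratic penalty.\<close>

definition "\<eta> k = \<rho>1 k *\<^sub>R (l k - z k) + (2 * \<rho>2 k) *\<^sub>R (g (w k) + s k)"

lemma wbar_Omega: "wbar \<in> Omega G"
  using MFCQ_upper by (auto simp: MFCQ_ineq_def MFCQ_def Omega_def less_eq_vec_def)

text \<open>\<open>U\<close> contains whole fibres over \<open>Xset G\<close>, which matters because
  \<open>(x k, \<theta> k)\<close> may lie outside \<open>Omega G\<close>.\<close>

lemma Omega_U: "(a, b) \<in> Omega G \<Longrightarrow> (a, v) \<in> U"
  using U(2) by (auto simp: Xset_def)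

lemmas in_U = Omega_U[OF xy_Omega] Omega_U[OF wbar_Omega]

lemma C1: "C1_on U f" "C1_on U (gradient f)" "C1_on U (\<lambda>w. g w $ i)"
    "C1_on U (gradient (\<lambda>w. g w $ i))"
  using f_C2 g_C2[of i] by (auto simp: C2_on_def)

lemmas GDERIVs = C1_on_GDERIV[OF C1(1)] C1_on_GDERIV[OF C1(3)]

lemma GDERIV_G: "GDERIV (\<lambda>u. G u $ j) wbar :> gradient (\<lambda>u. G u $ j) wbar"
  using G_C1_convex[of j] wbar_Omega C1_on_GDERIV by blast

lemma GDERIV_Lag_y:
  assumes "(a, v) \<in> U"
  shows "GDERIV (\<lambda>\<theta>. Lag f g a \<theta> c) v :> snd (lag_gradient f g c (a, v))"
  using GDERIV_snd[OF GDERIV_Lag[OF GDERIVs(1)[OF assms] GDERIVs(2)[OF assms]]] by simp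

lemma zs_nonneg: "0 \<le> z k $ i" "0 \<le> s k $ i" "z k $ i * s k $ i = 0"
  using zs_C[of k] by (auto simp: Ccompl_def less_eq_vec_def)

lemma Lag_convex: "convex_on UNIV (\<lambda>\<theta>. Lag f g (x k) \<theta> (z k))"
proof -
  have X: "x k \<in> Xset G"
    using xy_Omega[of k] by (auto simp: Xset_def)
  have "convex_on UNIV (\<lambda>\<theta>. f (x k, \<theta>) + (\<Sum>i\<in>UNIV. z k $ i * g (x k, \<theta>) $ i))"
    by (intro convex_on_add f_convex X convex_on_weighted_sum g_convex zs_nonneg) simp_all
  then show ?thesis
    by (simp add: Lag_def inner_vec_def)
qed

lemma \<theta>_optimal: "snd (lag_gradient f g (z k) (x k, \<theta> k)) = (1 / \<gamma>1) *\<^sub>R (y k - \<theta> k)"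
  using arg_min_proximal(2)[OF Lag_convex GDERIV_Lag_y[OF in_U(1)] gamma_pos(1), where y = "y k"]
  by (simp add: \<theta>_def theta_star_def Lag_def)

lemma l_nth: "l k $ i = max 0 (z k $ i + \<gamma>2 * g (w k) $ i)"
  by (simp add: l_def lambda_star_nth)

lemma gap_bound:
  "(norm (l k - z k))\<^sup>2 / (2 * \<gamma>2) + (norm (\<theta> k - y k))\<^sup>2 / (2 * \<gamma>1) \<le> gap f g \<gamma>1 \<gamma>2 (x k) (y k) (z k)"
  unfolding \<theta>_def l_def
  by (rule gap_lower_bound[OF Lag_convex GDERIV_Lag_y[OF in_U(1)] gamma_pos])
    (simp add: less_eq_vec_def zs_nonneg)

lemma maximizers_lim: "(\<lambda>k. \<theta> k - y k) \<longlonglongrightarrow> 0" "(\<lambda>k. l k - z k) \<longlonglongrightarrow> 0"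
proof -
  let ?gap = "\<lambda>k. gap f g \<gamma>1 \<gamma>2 (x k) (y k) (z k)"
  have bounds: "(norm (\<theta> k - y k))\<^sup>2 \<le> 2 * \<gamma>1 * ?gap k" "(norm (l k - z k))\<^sup>2 \<le> 2 * \<gamma>2 * ?gap k" for k
  proof -
    have "0 \<le> (norm (l k - z k))\<^sup>2 / (2 * \<gamma>2)" "0 \<le> (norm (\<theta> k - y k))\<^sup>2 / (2 * \<gamma>1)"
      using gamma_pos by auto
    then have "(norm (\<theta> k - y k))\<^sup>2 / (2 * \<gamma>1) \<le> ?gap k" "(norm (l k - z k))\<^sup>2 / (2 * \<gamma>2) \<le> ?gap k"
      using gap_bound[of k] by linarith+
    then show "(norm (\<theta> k - y k))\<^sup>2 \<le> 2 * \<gamma>1 * ?gap k" "(norm (l k - z k))\<^sup>2 \<le> 2 * \<gamma>2 * ?gap k"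
      using gamma_pos by (simp_all add: field_simps)
  qed
  have "v \<longlonglongrightarrow> 0" if "\<And>k. (norm (v k))\<^sup>2 \<le> 2 * \<gamma> * ?gap k" for \<gamma> and v :: "nat \<Rightarrow> 'z::real_normed_vector"
  proof (rule tendsto_zero_norm_square, rule tendsto_sandwich[OF _ _ tendsto_const])
    show "(\<lambda>k. 2 * \<gamma> * ?gap k) \<longlonglongrightarrow> 0"
      using tendsto_mult_left[OF gap_lim, of "2 * \<gamma>"] by simp
  qed (auto intro: always_eventually that)
  from this[OF bounds(1)] this[OF bounds(2)]
  show "(\<lambda>k. \<theta> k - y k) \<longlonglongrightarrow> 0" "(\<lambda>k. l k - z k) \<longlonglongrightarrow> 0" .
qed

section \<open>Limits of the data and feasibility of the limit point\<close>

lemma x_lim: "x \<longlonglongrightarrow> xbar" and y_lim: "y \<longlonglongrightarrow> ybar"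
  using tendsto_fst[OF xy_lim] tendsto_snd[OF xy_lim] by simp_all

lemma \<theta>_lim: "(\<lambda>k. (x k, \<theta> k)) \<longlonglongrightarrow> wbar"
proof -
  have "(\<lambda>k. (\<theta> k - y k) + y k) \<longlonglongrightarrow> 0 + ybar"
    by (intro tendsto_add maximizers_lim y_lim)
  then show ?thesis
    by (intro tendsto_Pair x_lim) simp
qed

lemma g_tendsto: "(a \<longlongrightarrow> wbar) E \<Longrightarrow> ((\<lambda>k. g (a k)) \<longlongrightarrow> g wbar) E"
  by (intro vec_tendstoI tendsto_continuous_on_open[OF C1_on_continuous_on[OF C1(3)] U(1) in_U(2)])

lemma jacobian_tendsto:
  assumes "a \<longlonglongrightarrow> wbar" "c \<longlonglongrightarrow> c'"
  shows "(\<lambda>k. jacobian_T g (a k) (c k)) \<longlonglongrightarrow> jacobian_T g wbar c'"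
  unfolding jacobian_T_def
  by (intro tendsto_intros tendsto_vec_nth assms
      tendsto_continuous_on_open[OF C1_on_continuous_on[OF C1(4)] U(1) in_U(2)])

lemma lag_gradient_tendsto:
  assumes "a \<longlonglongrightarrow> wbar" "c \<longlonglongrightarrow> c'"
  shows "(\<lambda>k. lag_gradient f g (c k) (a k)) \<longlonglongrightarrow> lag_gradient f g c' wbar"
  unfolding lag_gradient_def
  by (intro tendsto_add jacobian_tendsto assms
      tendsto_continuous_on_open[OF C1_on_continuous_on[OF C1(2)] U(1) in_U(2)])

lemma gradient_F_tendsto: "a \<longlonglongrightarrow> wbar \<Longrightarrow> (\<lambda>k. gradient F (a k)) \<longlonglongrightarrow> gradient F wbar"
  using tendsto_continuous_on_open[OF C1_on_continuous_on_gradient[OF F_C1(3)] F_C1(1)]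
    F_C1(2) wbar_Omega by blast

lemma eps_lims: "(\<lambda>k. fst (\<epsilon> k)) \<longlonglongrightarrow> 0" "(\<lambda>k. fst (snd (\<epsilon> k))) \<longlonglongrightarrow> 0"
    "(\<lambda>k. snd (snd (\<epsilon> k))) \<longlonglongrightarrow> 0"
  using tendsto_fst[OF eps_lim] tendsto_fst[OF tendsto_snd[OF eps_lim]]
    tendsto_snd[OF tendsto_snd[OF eps_lim]] by simp_all

text \<open>The vanishing residual makes \<open>s\<close> the slack of \<open>g\<close> in the
  limit, so complementarity of \<open>z\<close> and \<open>s\<close> becomes that of
  \<open>zbar\<close> and \<open>- g wbar\<close>.\<close>

lemma s_lim: "s \<longlonglongrightarrow> - g wbar"
  using tendsto_diff[OF gs_lim g_tendsto[OF xy_lim]] by simp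

lemma bar_complementary: "0 \<le> zbar $ i" "g wbar $ i \<le> 0" "zbar $ i * g wbar $ i = 0"
proof -
  note zi = tendsto_vec_nth[OF z_lim, of i] and si = tendsto_vec_nth[OF s_lim, of i]
  show "0 \<le> zbar $ i"
    by (rule LIMSEQ_le_const[OF zi]) (simp add: zs_nonneg)
  have "0 \<le> (- g wbar) $ i"
    by (rule LIMSEQ_le_const[OF si]) (simp add: zs_nonneg)
  then show "g wbar $ i \<le> 0" by simp
  have "(\<lambda>k. z k $ i * s k $ i) \<longlonglongrightarrow> zbar $ i * (- g wbar) $ i"
    by (intro tendsto_mult zi si)
  then have "(\<lambda>k::nat. 0 :: real) \<longlonglongrightarrow> zbar $ i * (- g wbar) $ i"
    by (simp only: zs_nonneg)
  from LIMSEQ_unique[OF this tendsto_const] show "zbar $ i * g wbar $ i = 0"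
    by simp
qed

text \<open>The optimality condition is exact at \<open>\<theta> k\<close>, not at
  \<open>y k\<close>. Both points have the limit \<open>ybar\<close>, and the right-hand side
  vanishes with \<open>y k - \<theta> k\<close>.\<close>

lemma lower_level_stationary: "snd (lag_gradient f g zbar wbar) = 0"
proof (rule LIMSEQ_unique)
  show "(\<lambda>k. snd (lag_gradient f g (z k) (x k, \<theta> k))) \<longlonglongrightarrow> snd (lag_gradient f g zbar wbar)"
    by (intro tendsto_snd lag_gradient_tendsto \<theta>_lim z_lim)
  have "(\<lambda>k. (1 / \<gamma>1) *\<^sub>R - (\<theta> k - y k)) \<longlonglongrightarrow> (1 / \<gamma>1) *\<^sub>R - 0"
    by (intro tendsto_intros maximizers_lim)
  then show "(\<lambda>k. snd (lag_gradient f g (z k) (x k, \<theta> k))) \<longlonglongrightarrow> 0"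
    by (simp add: \<theta>_optimal)
qed

lemma feasible: "MPCC_feasible f G g xbar ybar zbar"
proof -
  have "gradient (\<lambda>y. Lag f g xbar y zbar) ybar = 0"
    using gradient_eqI[OF GDERIV_Lag_y[OF in_U(2)]] lower_level_stationary by simp
  moreover have "orthogonal zbar (- g wbar)"
    by (simp add: orthogonal_def inner_vec_def bar_complementary(3))
  ultimately show ?thesis
    using wbar_Omega bar_complementary
    by (simp add: MPCC_feasible_def Omega_def less_eq_vec_def)
qed

section \<open>The blocks of the stationarity inclusion and the limits of normals\<close>

lemma stationary_decomposition:
  obtains \<xi> \<zeta> \<sigma> where
    "\<And>k. \<xi> k \<in> limiting_normal_cone (Omega G) (w k)"
    "\<And>k. (\<zeta> k, \<sigma> k) \<in> limiting_normal_cone Ccompl (z k, s k)"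
    "\<And>k. fst (\<epsilon> k) = gradient F (w k)
      + \<rho>1 k *\<^sub>R (lag_gradient f g (z k) (w k) - lag_gradient f g (z k) (x k, \<theta> k))
      + jacobian_T g (w k) (\<eta> k) + \<xi> k"
    "\<And>k. fst (snd (\<epsilon> k)) = \<rho>1 k *\<^sub>R ((1 / \<gamma>2) *\<^sub>R (l k - z k) - g (x k, \<theta> k)) + \<zeta> k"
    "\<And>k. snd (snd (\<epsilon> k)) = (2 * \<rho>2 k) *\<^sub>R (g (w k) + s k) + \<sigma> k"
proof -
  have "\<forall>k. \<exists>n. n \<in> limiting_normal_cone (Omega G) (w k) \<times> limiting_normal_cone Ccompl (z k, s k) \<and>
      \<epsilon> k = (gradient F (w k), (0, 0))
        + \<rho>1 k *\<^sub>R (fst (gap_gradient f g \<gamma>1 \<gamma>2 (x k) (y k) (z k)),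
                   (snd (gap_gradient f g \<gamma>1 \<gamma>2 (x k) (y k) (z k)), 0))
        + \<rho>2 k *\<^sub>R gradient (\<lambda>((x, y), (z, s)). (norm (g (x, y) + s))\<^sup>2)
                     ((x k, y k), (z k, s k)) + n"
    using stationary by blast
  then obtain n where n: "\<And>k. n k \<in> limiting_normal_cone (Omega G) (w k) \<times> limiting_normal_cone Ccompl (z k, s k)"
    and eq: "\<And>k. \<epsilon> k = (gradient F (w k), (0, 0))
        + \<rho>1 k *\<^sub>R (fst (gap_gradient f g \<gamma>1 \<gamma>2 (x k) (y k) (z k)),
                   (snd (gap_gradient f g \<gamma>1 \<gamma>2 (x k) (y k) (z k)), 0))
        + \<rho>2 k *\<^sub>R gradient (\<lambda>((x, y), (z, s)). (norm (g (x, y) + s))\<^sup>2)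
                     ((x k, y k), (z k, s k)) + n k"
    by metis
  have gap: "fst (gap_gradient f g \<gamma>1 \<gamma>2 (x k) (y k) (z k))
      = lag_gradient f g (z k) (w k) - lag_gradient f g (z k) (x k, \<theta> k) + jacobian_T g (w k) (l k - z k)"
    "snd (gap_gradient f g \<gamma>1 \<gamma>2 (x k) (y k) (z k)) = (1 / \<gamma>2) *\<^sub>R (l k - z k) - g (x k, \<theta> k)" for k
    unfolding \<theta>_def l_def
    by (rule gap_gradient_eq[OF GDERIVs(1) GDERIVs(1) GDERIVs(2) GDERIVs(2)];
        (rule in_U)?; rule \<theta>_optimal[unfolded \<theta>_def])+
  note pen = gradient_penalty[OF GDERIVs(2)[OF in_U(1)]]
  show ?thesis
  proof (rule that[of "\<lambda>k. fst (n k)" "\<lambda>k. fst (snd (n k))" "\<lambda>k. snd (snd (n k))"])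
    fix k
    show "fst (n k) \<in> limiting_normal_cone (Omega G) (w k)"
      "(fst (snd (n k)), snd (snd (n k))) \<in> limiting_normal_cone Ccompl (z k, s k)"
      using n[of k] by (auto simp: mem_Times_iff)
    show "fst (\<epsilon> k) = gradient F (w k)
      + \<rho>1 k *\<^sub>R (lag_gradient f g (z k) (w k) - lag_gradient f g (z k) (x k, \<theta> k))
      + jacobian_T g (w k) (\<eta> k) + fst (n k)"
      unfolding eq[of k] gap pen \<eta>_def jacobian_T_add jacobian_T_scaleR
      by (simp add: scaleR_add_right algebra_simps)
    show "fst (snd (\<epsilon> k)) = \<rho>1 k *\<^sub>R ((1 / \<gamma>2) *\<^sub>R (l k - z k) - g (x k, \<theta> k)) + fst (snd (n k))"
      unfolding eq[of k] gap pen by simp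
    show "snd (snd (\<epsilon> k)) = (2 * \<rho>2 k) *\<^sub>R (g (w k) + s k) + snd (snd (n k))"
      unfolding eq[of k] gap pen by (simp add: mult.commute)
  qed
qed

text \<open>The normals themselves may be unbounded. Convexity of \<open>Omega G\<close> makes
  normality a family of linear inequalities, stable under nonnegative scaling and limits, so the
  limit of the scaled normals has multipliers.\<close>

lemma scaled_normals_limit:
  assumes a: "a \<longlonglongrightarrow> wbar" "\<And>k. a k \<in> Omega G"
    and \<xi>: "\<And>k. \<xi> k \<in> limiting_normal_cone (Omega G) (a k)"
    and \<beta>: "\<And>k. 0 \<le> \<beta> k" "(\<lambda>k. \<beta> k *\<^sub>R \<xi> k) \<longlonglongrightarrow> v"
  obtains \<mu> where "0 \<le> \<mu>" "jacobian_T G wbar \<mu> = v" "\<And>j. \<mu> $ j * G wbar $ j = 0"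
proof (rule normal_cone_of_system[OF MFCQ_upper GDERIV_G])
  fix u assume "G u \<le> 0"
  then have u: "u \<in> Omega G"
    by (auto simp: Omega_def case_prod_unfold)
  have "\<beta> k *\<^sub>R \<xi> k \<bullet> (u - a k) \<le> 0" for k
    using \<xi>[of k] u \<beta>(1)[of k]
    unfolding limiting_normal_cone_convex[OF convex_Omega[OF G_C1_convex] a(2)]
    by (simp add: mult_nonneg_nonpos)
  then show "v \<bullet> (u - wbar) \<le> 0"
    by (intro LIMSEQ_le_const2[OF tendsto_inner[OF \<beta>(2) tendsto_diff[OF tendsto_const a(1)]]]) auto
qed (rule that)

text \<open>The definition differentiates in \<open>y\<close> alone. Since the whole fibre over
  \<open>xbar\<close> lies in \<open>U\<close>, the explicit Lagrangian gradient is valid for every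
  \<open>y\<close>, and its derivative along \<open>(0, v)\<close> is the Hessian part.\<close>

lemma stationarity_multipliersI:
  assumes "0 \<le> \<mu>" "\<And>j. \<mu> $ j * G wbar $ j = 0"
    and "gradient F wbar + jacobian_T G wbar \<mu> + lag_hessian f g zbar wbar (0, \<omega>') + jacobian_T g wbar \<eta>' = 0"
    and "\<And>i. g wbar $ i < 0 \<Longrightarrow> \<eta>' $ i = 0"
    and "\<And>i. zbar $ i > 0 \<Longrightarrow> snd (gradient (\<lambda>u. g u $ i) wbar) \<bullet> \<omega>' = 0"
  shows "stationarity_multipliers F f G g xbar ybar zbar \<mu> \<omega>' \<eta>'"
proof -
  have "(\<lambda>y. gradient (\<lambda>(x, y). Lag f g x y zbar) (xbar, y)) = (\<lambda>y. lag_gradient f g zbar (xbar, y))"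
    using gradient_eqI[OF GDERIV_Lag[OF GDERIVs(1)[OF in_U(2)] GDERIVs(2)[OF in_U(2)]]] by blast
  moreover have "((\<lambda>y. lag_gradient f g zbar (xbar, y)) has_derivative
      (\<lambda>v. lag_hessian f g zbar wbar (0, v))) (at ybar)"
  proof -
    have "((\<lambda>y. ((xbar, y), zbar)) has_derivative (\<lambda>v. ((0, v), 0))) (at ybar)"
      by (auto intro!: derivative_eq_intros)
    from has_derivative_compose[OF this has_derivative_lag_gradient[OF f_C2 g_C2 in_U(2)]]
    show ?thesis
      by (simp add: jacobian_T_def)
  qed
  ultimately have "frechet_derivative (\<lambda>y. gradient (\<lambda>(x, y). Lag f g x y zbar) (xbar, y)) (at ybar) \<omega>'
      = lag_hessian f g zbar wbar (0, \<omega>')"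
    by (metis (no_types, lifting) frechet_derivative_at)
  moreover have "gradient (\<lambda>y. g (xbar, y) $ i) ybar = snd (gradient (\<lambda>u. g u $ i) wbar)" for i
    using gradient_eqI[OF GDERIV_snd[OF GDERIVs(2)[OF in_U(2)]]] .
  ultimately show ?thesis
    using assms by (auto simp: stationarity_multipliers_def I_zero_plus_def I_plus_zero_def)
qed

section \<open>The two regimes of the penalty parameters\<close>

lemma S_stationary_if_bounded:
  assumes "bounded (range \<rho>1)" "bounded (range \<rho>2)"
  shows "S_stationary F f G g xbar ybar zbar"
proof -
  obtain \<xi> where \<xi>: "\<And>k. \<xi> k \<in> limiting_normal_cone (Omega G) (w k)"
    "\<And>k. fst (\<epsilon> k) = gradient F (w k)
      + \<rho>1 k *\<^sub>R (lag_gradient f g (z k) (w k) - lag_gradient f g (z k) (x k, \<theta> k))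
      + jacobian_T g (w k) (\<eta> k) + \<xi> k"
    using stationary_decomposition by metis
  have "(\<lambda>k. lag_gradient f g (z k) (w k) - lag_gradient f g (z k) (x k, \<theta> k)) \<longlonglongrightarrow>
      lag_gradient f g zbar wbar - lag_gradient f g zbar wbar"
    by (intro tendsto_diff lag_gradient_tendsto z_lim xy_lim \<theta>_lim)
  then have 1: "(\<lambda>k. \<rho>1 k *\<^sub>R (lag_gradient f g (z k) (w k) - lag_gradient f g (z k) (x k, \<theta> k))) \<longlonglongrightarrow> 0"
    by (intro tendsto_bounded_times_zero assms) simp
  have "(\<lambda>k. \<rho>1 k *\<^sub>R (l k - z k) + 2 *\<^sub>R \<rho>2 k *\<^sub>R (g (w k) + s k)) \<longlonglongrightarrow> 0 + 2 *\<^sub>R 0"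
    by (intro tendsto_add tendsto_scaleR tendsto_const tendsto_bounded_times_zero assms
        maximizers_lim gs_lim)
  then have "\<eta> \<longlonglongrightarrow> 0"
    by (simp add: \<eta>_def[abs_def])
  then have 2: "(\<lambda>k. jacobian_T g (w k) (\<eta> k)) \<longlonglongrightarrow> 0"
    using jacobian_tendsto[OF xy_lim] by (fastforce simp: jacobian_T_def)
  have "(\<lambda>k. fst (\<epsilon> k) - gradient F (w k)
      - \<rho>1 k *\<^sub>R (lag_gradient f g (z k) (w k) - lag_gradient f g (z k) (x k, \<theta> k))
      - jacobian_T g (w k) (\<eta> k)) \<longlonglongrightarrow> 0 - gradient F wbar - 0 - 0"
    by (intro tendsto_diff eps_lims gradient_F_tendsto xy_lim 1 2)
  then have lim: "(\<lambda>k. 1 *\<^sub>R \<xi> k) \<longlonglongrightarrow> - gradient F wbar"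
    by (simp add: \<xi>(2))
  obtain \<mu> where \<mu>: "0 \<le> \<mu>" "jacobian_T G wbar \<mu> = - gradient F wbar" "\<And>j. \<mu> $ j * G wbar $ j = 0"
    by (rule scaled_normals_limit[OF xy_lim xy_Omega \<xi>(1) zero_le_one lim], rule that)
  have "lag_hessian f g zbar wbar (0, 0) = 0"
    using linear_0[OF linear_lag_hessian[OF f_C2 g_C2 in_U(2)]] by (simp add: zero_prod_def)
  moreover have "jacobian_T g wbar 0 = 0"
    by (simp add: jacobian_T_def)
  ultimately have "stationarity_multipliers F f G g xbar ybar zbar \<mu> 0 0"
    using \<mu> by (intro stationarity_multipliersI) simp_all
  then show ?thesis
    unfolding S_stationary_def using feasible by (intro conjI exI[of _ \<mu>] exI[of _ 0]) auto
qed

lemma M_stationary_if_ratio_vanishes: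
  assumes ratio: "(\<lambda>k. \<rho>1 k / \<rho>2 k) \<longlonglongrightarrow> 0" and mfcq: "MPCC_MFCQ f G g xbar ybar zbar"
  shows "M_stationary F f G g xbar ybar zbar"
proof -
  obtain \<xi> \<zeta> \<sigma> where dec:
    "\<And>k. \<xi> k \<in> limiting_normal_cone (Omega G) (w k)"
    "\<And>k. (\<zeta> k, \<sigma> k) \<in> limiting_normal_cone Ccompl (z k, s k)"
    "\<And>k. fst (\<epsilon> k) = gradient F (w k)
      + \<rho>1 k *\<^sub>R (lag_gradient f g (z k) (w k) - lag_gradient f g (z k) (x k, \<theta> k))
      + jacobian_T g (w k) (\<eta> k) + \<xi> k"
    "\<And>k. fst (snd (\<epsilon> k)) = \<rho>1 k *\<^sub>R ((1 / \<gamma>2) *\<^sub>R (l k - z k) - g (x k, \<theta> k)) + \<zeta> k"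
    "\<And>k. snd (snd (\<epsilon> k)) = (2 * \<rho>2 k) *\<^sub>R (g (w k) + s k) + \<sigma> k"
    using stationary_decomposition by blast
  \<comment> \<open>Rescaling covers bounded and unbounded multipliers at once: if \<open>c\<close> has a positive limit, division
    by it gives the multipliers; if \<open>c\<close> tends to \<open>0\<close>, the limit has norm one and violates MPCC-MFCQ.\<close>
  define c where "c k = 1 / max 1 (norm (\<omega> k, \<eta> k))" for k
  have c: "0 < c k" "c k \<le> 1" for k
    by (auto simp: c_def)
  have c_norm: "norm (c k *\<^sub>R (\<omega> k, \<eta> k)) \<le> 1" for k
    by (simp add: c_def field_simps del: scaleR_Pair)
  let ?K = "{0..1::real} \<times> cball (0 :: (real^'m) \<times> (real^'q)) 1"
  have "seq_compact ?K"
    by (simp add: compact_Times compact_imp_seq_compact)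
  moreover have "\<forall>k. (c k, c k *\<^sub>R (\<omega> k, \<eta> k)) \<in> ?K"
    using c c_norm by (auto simp: less_imp_le simp del: scaleR_Pair)
  ultimately obtain t r where t: "t \<in> ?K" and r: "strict_mono r"
    and t_lim: "((\<lambda>k. (c k, c k *\<^sub>R (\<omega> k, \<eta> k))) \<circ> r) \<longlonglongrightarrow> t"
    by (rule seq_compactE)
  obtain cb \<omega>b \<eta>b where tb: "t = (cb, \<omega>b, \<eta>b)"
    by (cases t)
  have c_lim: "(\<lambda>k. c (r k)) \<longlonglongrightarrow> cb"
    and p_lim: "(\<lambda>k. c (r k) *\<^sub>R (\<omega> (r k), \<eta> (r k))) \<longlonglongrightarrow> (\<omega>b, \<eta>b)"
    using tendsto_fst[OF t_lim] tendsto_snd[OF t_lim] by (simp_all add: tb comp_def)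
  have \<omega>_lim: "(\<lambda>k. c (r k) *\<^sub>R \<omega> (r k)) \<longlonglongrightarrow> \<omega>b" and \<eta>_lim: "(\<lambda>k. c (r k) *\<^sub>R \<eta> (r k)) \<longlonglongrightarrow> \<eta>b"
    using tendsto_fst[OF p_lim] tendsto_snd[OF p_lim] by simp_all
  have sub: "(\<lambda>k. X (r k)) \<longlonglongrightarrow> L" if "X \<longlonglongrightarrow> L" for X :: "nat \<Rightarrow> 'z::topological_space" and L
    using LIMSEQ_subseq_LIMSEQ[OF that r] by (simp add: comp_def)
  note w_lim' = sub[OF xy_lim] and \<theta>_lim' = sub[OF \<theta>_lim] and z_lim' = sub[OF z_lim]
  \<comment> \<open>The points \<open>w\<close> and \<open>(x, \<theta>)\<close> differ only in the
    second component; this factor turns their difference into the rescaled \<open>\<omega>\<close>,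
    which converges.\<close>
  let ?\<beta> = "\<lambda>k. c (r k) * \<rho>1 (r k)"
  have "(\<lambda>k. (0 :: real^'n, c (r k) *\<^sub>R \<omega> (r k))) \<longlonglongrightarrow> (0, \<omega>b)"
    by (intro tendsto_Pair tendsto_const \<omega>_lim)
  then have \<beta>_lim: "(\<lambda>k. ?\<beta> k *\<^sub>R (w (r k) - (x (r k), \<theta> (r k)))) \<longlonglongrightarrow> (0, \<omega>b)"
    by (simp add: \<omega>_def)
  note diff_lim = tendsto_scaled_difference[OF U(1) _ in_U(2) w_lim' \<theta>_lim' \<beta>_lim]
  have H_lim: "(\<lambda>k. ?\<beta> k *\<^sub>R (lag_gradient f g (z (r k)) (w (r k))
      - lag_gradient f g (z (r k)) (x (r k), \<theta> (r k)))) \<longlonglongrightarrow> lag_hessian f g zbar wbar (0, \<omega>b)"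
  proof -
    \<comment> \<open>The factor may diverge, so it is kept with each gradient difference, where
      \<open>diff_lim\<close> applies; the weights \<open>z\<close> converge separately.\<close>
    have "?\<beta> k *\<^sub>R (lag_gradient f g (z (r k)) (w (r k)) - lag_gradient f g (z (r k)) (x (r k), \<theta> (r k)))
        = ?\<beta> k *\<^sub>R (gradient f (w (r k)) - gradient f (x (r k), \<theta> (r k)))
        + (\<Sum>i\<in>UNIV. z (r k) $ i *\<^sub>R (?\<beta> k *\<^sub>R (gradient (\<lambda>u. g u $ i) (w (r k))
            - gradient (\<lambda>u. g u $ i) (x (r k), \<theta> (r k)))))" for k
      by (simp add: lag_gradient_def jacobian_T_def scaleR_sum_right scaleR_diff_right scaleR_add_right
          sum_subtractf mult.commute)
    then show ?thesis
      unfolding lag_hessian_def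
      by (simp only:) (intro tendsto_add tendsto_sum tendsto_scaleR tendsto_vec_nth z_lim' diff_lim C1)
  qed
  have \<xi>_lim: "(\<lambda>k. c (r k) *\<^sub>R \<xi> (r k)) \<longlonglongrightarrow>
      - (cb *\<^sub>R gradient F wbar + lag_hessian f g zbar wbar (0, \<omega>b) + jacobian_T g wbar \<eta>b)"
  proof -
    have "c (r k) *\<^sub>R \<xi> (r k) = c (r k) *\<^sub>R fst (\<epsilon> (r k)) - c (r k) *\<^sub>R gradient F (w (r k))
        - ?\<beta> k *\<^sub>R (lag_gradient f g (z (r k)) (w (r k)) - lag_gradient f g (z (r k)) (x (r k), \<theta> (r k)))
        - jacobian_T g (w (r k)) (c (r k) *\<^sub>R \<eta> (r k))" for k
      by (simp add: dec(3) jacobian_T_scaleR scaleR_add_right)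
    moreover have "(\<lambda>k. c (r k) *\<^sub>R fst (\<epsilon> (r k)) - c (r k) *\<^sub>R gradient F (w (r k))
        - ?\<beta> k *\<^sub>R (lag_gradient f g (z (r k)) (w (r k)) - lag_gradient f g (z (r k)) (x (r k), \<theta> (r k)))
        - jacobian_T g (w (r k)) (c (r k) *\<^sub>R \<eta> (r k))) \<longlonglongrightarrow>
        cb *\<^sub>R 0 - cb *\<^sub>R gradient F wbar - lag_hessian f g zbar wbar (0, \<omega>b) - jacobian_T g wbar \<eta>b"
      by (intro tendsto_diff tendsto_scaleR c_lim sub[OF eps_lims(1)] gradient_F_tendsto
          w_lim' H_lim jacobian_tendsto \<eta>_lim)
    ultimately have "(\<lambda>k. c (r k) *\<^sub>R \<xi> (r k)) \<longlonglongrightarrow> cb *\<^sub>R 0 - cb *\<^sub>R gradient F wbar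
        - lag_hessian f g zbar wbar (0, \<omega>b) - jacobian_T g wbar \<eta>b"
      by (simp only:)
    moreover have "cb *\<^sub>R 0 - cb *\<^sub>R gradient F wbar
        - lag_hessian f g zbar wbar (0, \<omega>b) - jacobian_T g wbar \<eta>b
        = - (cb *\<^sub>R gradient F wbar + lag_hessian f g zbar wbar (0, \<omega>b) + jacobian_T g wbar \<eta>b)"
      by (simp add: algebra_simps)
    ultimately show ?thesis
      by (simp only:)
  qed
  obtain \<mu> where \<mu>: "0 \<le> \<mu>"
    and \<mu>_eq: "jacobian_T G wbar \<mu>
      = - (cb *\<^sub>R gradient F wbar + lag_hessian f g zbar wbar (0, \<omega>b) + jacobian_T g wbar \<eta>b)"
    and \<mu>_compl: "\<And>j. \<mu> $ j * G wbar $ j = 0"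
    by (rule scaled_normals_limit[OF w_lim' xy_Omega dec(1) less_imp_le[OF c(1)] \<xi>_lim], rule that)
  have stat: "cb *\<^sub>R gradient F wbar + jacobian_T G wbar \<mu> + lag_hessian f g zbar wbar (0, \<omega>b)
      + jacobian_T g wbar \<eta>b = 0"
    by (simp add: \<mu>_eq)
  let ?b = "\<lambda>i. snd (gradient (\<lambda>u. g u $ i) wbar) \<bullet> \<omega>b"
  have signs: "(0 \<le> \<eta>b $ i \<and> 0 \<le> ?b i \<or> \<eta>b $ i * ?b i = 0) \<and>
      (zbar $ i > 0 \<longrightarrow> ?b i = 0) \<and> (g wbar $ i < 0 \<longrightarrow> \<eta>b $ i = 0)" for i
  proof -
    define \<kappa> where "\<kappa> k = \<rho>1 k / (2 * \<rho>2 k)" for k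
    \<comment> \<open>This term appears when \<open>g (x, \<theta>)\<close> in the
      \<open>z\<close>-row is replaced by \<open>g (x, y)\<close>. After multiplication by
      \<open>c\<close> it tends to \<open>?b i\<close> along \<open>r\<close>.\<close>
    define b where "b k = \<rho>1 k * (g (w k) $ i - g (x k, \<theta> k) $ i)" for k
    define e where "e k = \<bar>fst (snd (\<epsilon> k)) $ i\<bar> + \<bar>snd (snd (\<epsilon> k)) $ i\<bar>" for k
    define err where "err k = (1 + \<gamma>2 * \<kappa> k) * e k + (1 + \<gamma>2) * \<kappa> k * \<bar>\<eta> k $ i\<bar>" for k
    have "\<exists>a b'. (0 \<le> a \<and> 0 \<le> b' \<or> a * b' = 0) \<and> (z k $ i > 0 \<longrightarrow> b' = 0) \<and> (s k $ i > 0 \<longrightarrow> a = 0) \<and>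
        \<bar>\<eta> k $ i - a\<bar> \<le> err k \<and>
        \<bar>b k - b'\<bar> \<le> err k" for k
    proof -
      have max_eq: "max 0 (a + \<gamma>2 * v) - a = max (- a) (\<gamma>2 * v)"
        "(1 / \<gamma>2) * (max 0 (a + \<gamma>2 * v) - a) - v = max (- a / \<gamma>2 - v) 0" for a v
        using gamma_pos(2) by (auto simp: max_def field_simps)
      have "fst (snd (\<epsilon> k)) $ i = \<rho>1 k * ((1 / \<gamma>2) * (l k $ i - z k $ i) - g (w k) $ i) + b k + \<zeta> k $ i"
        by (simp add: dec(4) b_def algebra_simps)
      then have 1: "fst (snd (\<epsilon> k)) $ i
          = \<rho>1 k * max (- z k $ i / \<gamma>2 - g (w k) $ i) 0 + b k + \<zeta> k $ i"
        unfolding l_nth max_eq(2) .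
      have 2: "snd (snd (\<epsilon> k)) $ i = 2 * \<rho>2 k * (g (w k) $ i + s k $ i) + \<sigma> k $ i"
        by (simp add: dec(5))
      have "\<eta> k $ i = \<rho>1 k * (l k $ i - z k $ i) + 2 * \<rho>2 k * (g (w k) $ i + s k $ i)"
        by (simp add: \<eta>_def)
      then have 3: "\<eta> k $ i = \<rho>1 k * max (- z k $ i) (\<gamma>2 * g (w k) $ i) + 2 * \<rho>2 k * (g (w k) $ i + s k $ i)"
        unfolding l_nth max_eq(1) .
      show ?thesis
        by (rule approximate_complementarity_multipliers[OF rho_pos gamma_pos(2) zs_nonneg
              limiting_normal_cone_Ccompl[OF dec(2)] 1 2 3])
          (unfold err_def \<kappa>_def e_def, blast+)
    qed
    then obtain a b' where ab: "\<And>k. 0 \<le> a k \<and> 0 \<le> b' k \<or> a k * b' k = 0"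
        "\<And>k. z k $ i > 0 \<Longrightarrow> b' k = 0" "\<And>k. s k $ i > 0 \<Longrightarrow> a k = 0"
        "\<And>k. \<bar>\<eta> k $ i - a k\<bar> \<le> err k"
        "\<And>k. \<bar>b k - b' k\<bar> \<le> err k"
      by metis
    \<comment> \<open>Since \<open>c * \<bar>\<eta> $ i\<bar> \<le> 1\<close>, rescaling caps the
      part of \<open>err\<close> that could grow with the multipliers by
      \<open>(1 + \<gamma>2) * \<kappa>\<close>.\<close>
    define \<delta> where "\<delta> k = (1 + \<gamma>2 * \<kappa> k) * e k + (1 + \<gamma>2) * \<kappa> k" for k
    have \<kappa>: "\<kappa> \<longlonglongrightarrow> 0"
      using tendsto_mult_left[OF ratio, of "1 / 2"] by (simp add: \<kappa>_def[abs_def])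
    have \<kappa>_pos: "0 \<le> \<kappa> k" for k
      using rho_pos by (simp add: \<kappa>_def less_imp_le)
    have "e \<longlonglongrightarrow> \<bar>0 $ i\<bar> + \<bar>0 $ i\<bar>"
      unfolding e_def[abs_def] by (intro tendsto_intros tendsto_vec_nth eps_lims)
    then have e: "e \<longlonglongrightarrow> 0" by simp
    have "\<delta> \<longlonglongrightarrow> (1 + \<gamma>2 * 0) * 0 + (1 + \<gamma>2) * 0"
      unfolding \<delta>_def[abs_def] by (intro tendsto_intros \<kappa> e)
    then have \<delta>: "(\<lambda>k. \<delta> (r k)) \<longlonglongrightarrow> 0" by (intro sub) simp
    have scaled: "c k * err k \<le> \<delta> k" for k
    proof -
      have "c k * \<bar>\<eta> k $ i\<bar> = \<bar>(c k *\<^sub>R \<eta> k) $ i\<bar>"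
        using c(1)[of k] by (simp add: abs_mult)
      also have "\<dots> \<le> norm (c k *\<^sub>R \<eta> k)"
        by (rule component_le_norm_cart)
      also have "\<dots> \<le> norm (c k *\<^sub>R (\<omega> k, \<eta> k))"
        by (metis norm_snd_le scaleR_Pair snd_conv)
      also note c_norm
      finally have "c k * \<bar>\<eta> k $ i\<bar> \<le> 1" .
      then have "(1 + \<gamma>2) * \<kappa> k * (c k * \<bar>\<eta> k $ i\<bar>) \<le> (1 + \<gamma>2) * \<kappa> k * 1"
        using gamma_pos(2) \<kappa>_pos by (intro mult_left_mono) auto
      moreover have "c k * ((1 + \<gamma>2 * \<kappa> k) * e k) \<le> 1 * ((1 + \<gamma>2 * \<kappa> k) * e k)"
        using c[of k] gamma_pos(2) \<kappa>_pos[of k] by (intro mult_right_mono) (auto simp: e_def)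
      ultimately show ?thesis
        by (simp add: \<delta>_def err_def algebra_simps)
    qed
    have close: "\<bar>c k * p - c k * q\<bar> \<le> \<delta> k"
      if "\<bar>p - q\<bar> \<le> err k" for p q k
    proof -
      have "\<bar>c k * p - c k * q\<bar> = c k * \<bar>p - q\<bar>"
        using c(1)[of k] by (simp add: abs_mult flip: right_diff_distrib)
      also have "\<dots> \<le> c k * err k"
        using c(1)[of k] that by (intro mult_left_mono) auto
      also note scaled
      finally show ?thesis .
    qed
    have transfer: "(\<lambda>k. c (r k) * q (r k)) \<longlonglongrightarrow> L"
      if p: "(\<lambda>k. c (r k) * p (r k)) \<longlonglongrightarrow> L"
        and pq: "\<And>k. \<bar>p k - q k\<bar> \<le> err k" for p q L
    proof -
      have "(\<lambda>k. c (r k) * p (r k) - c (r k) * q (r k)) \<longlonglongrightarrow> 0"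
        by (rule Lim_null_comparison[OF _ \<delta>]) (auto intro!: always_eventually close pq)
      from tendsto_diff[OF p this] show ?thesis by simp
    qed
    have "(\<lambda>k. c (r k) * \<eta> (r k) $ i) \<longlonglongrightarrow> \<eta>b $ i"
      using tendsto_vec_nth[OF \<eta>_lim, of i] by simp
    then have a_lim: "(\<lambda>k. c (r k) * a (r k)) \<longlonglongrightarrow> \<eta>b $ i"
      by (rule transfer) (rule ab(4))
    have "frechet_derivative (\<lambda>u. g u $ i) (at wbar) (0, \<omega>b) = ?b i"
      using C1(3)[of i] in_U(2)
      by (simp add: C1_on_def frechet_derivative_gradient inner_prod_def inner_commute)
    then have "(\<lambda>k. c (r k) * b (r k)) \<longlonglongrightarrow> ?b i"
      using diff_lim[OF C1(3)[of i]] by (simp add: b_def mult.assoc)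
    then have b_lim: "(\<lambda>k. c (r k) * b' (r k)) \<longlonglongrightarrow> ?b i"
      by (rule transfer) (rule ab(5))
    have "?b i = 0" if "zbar $ i > 0"
    proof (rule LIMSEQ_unique[OF b_lim])
      have "eventually (\<lambda>k. z (r k) $ i > 0) sequentially"
        using order_tendstoD(1)[OF tendsto_vec_nth[OF z_lim'] that] .
      then show "(\<lambda>k. c (r k) * b' (r k)) \<longlonglongrightarrow> 0"
        by (intro tendsto_eventually) (auto elim!: eventually_mono simp: ab(2))
    qed
    moreover have "\<eta>b $ i = 0" if "g wbar $ i < 0"
    proof (rule LIMSEQ_unique[OF a_lim])
      have "0 < (- g wbar) $ i" using that by simp
      then have "eventually (\<lambda>k. s (r k) $ i > 0) sequentially"
        using order_tendstoD(1)[OF tendsto_vec_nth[OF sub[OF s_lim]]] by blast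
      then show "(\<lambda>k. c (r k) * a (r k)) \<longlonglongrightarrow> 0"
        by (intro tendsto_eventually) (auto elim!: eventually_mono simp: ab(3))
    qed
    moreover have "0 \<le> \<eta>b $ i \<and> 0 \<le> ?b i \<or> \<eta>b $ i * ?b i = 0"
    proof -
      \<comment> \<open>The sign alternative is invariant under the positive factor
        \<open>c k\<close> and describes a closed set, so it passes to the limit.\<close>
      let ?S = "{p::real\<times>real. 0 \<le> fst p} \<inter> {p. 0 \<le> snd p} \<union> {p. fst p * snd p = 0}"
      have "closed ?S"
        by (intro closed_Un closed_Int closed_Collect_le closed_Collect_eq continuous_intros)
      moreover have "(c k * a k, c k * b' k) \<in> ?S" for k
        using ab(1)[of k] c(1)[of k] by auto
      moreover have "(\<lambda>k. (c (r k) * a (r k), c (r k) * b' (r k))) \<longlonglongrightarrow> (\<eta>b $ i, ?b i)"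
        by (intro tendsto_Pair a_lim b_lim)
      ultimately have "(\<eta>b $ i, ?b i) \<in> ?S"
        using closed_sequentially[of ?S "\<lambda>k. (c (r k) * a (r k), c (r k) * b' (r k))"] by blast
      then show ?thesis by auto
    qed
    ultimately show ?thesis by blast
  qed
  have lin: "linear (lag_hessian f g zbar wbar)"
    by (rule linear_lag_hessian[OF f_C2 g_C2 in_U(2)])
  have "cb \<noteq> 0"
  proof
    assume "cb = 0"
    \<comment> \<open>With \<open>cb = 0\<close> the gradient of \<open>F\<close> drops out of
      \<open>stat\<close>, leaving the homogeneous relation that MPCC-MFCQ excludes.\<close>
    then have "\<omega>b = 0 \<and> \<eta>b = 0"
      using stat signs \<mu> \<mu>_compl bar_complementary
      by (intro MPCC_MFCQ_multipliers_zero[OF mfcq U(1) f_C2 g_C2 in_U(2) GDERIV_G, of \<mu>])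
        (auto simp: less_eq_vec_def I_plus_zero_def I_zero_plus_def)
    then have "(\<lambda>k. norm (c (r k) *\<^sub>R (\<omega> (r k), \<eta> (r k)))) \<longlonglongrightarrow> 0"
      using tendsto_norm[OF p_lim] by (simp add: norm_Pair del: scaleR_Pair)
    \<comment> \<open>Once \<open>c < 1\<close>, the maximum in its definition is the norm, so the
      rescaled vector has norm exactly 1.\<close>
    moreover have "eventually (\<lambda>k. norm (c (r k) *\<^sub>R (\<omega> (r k), \<eta> (r k))) = 1) sequentially"
      using order_tendstoD(2)[OF c_lim, of 1] \<open>cb = 0\<close>
      by (auto elim!: eventually_mono simp: c_def max_def simp del: scaleR_Pair split: if_splits)
    then have "(\<lambda>k. norm (c (r k) *\<^sub>R (\<omega> (r k), \<eta> (r k)))) \<longlonglongrightarrow> 1"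
      by (rule tendsto_eventually)
    ultimately show False
      using LIMSEQ_unique by fastforce
  qed
  then have cb: "cb > 0"
    using t by (auto simp: tb)
  let ?\<mu> = "(1 / cb) *\<^sub>R \<mu>" and ?\<omega> = "(1 / cb) *\<^sub>R \<omega>b" and ?\<eta> = "(1 / cb) *\<^sub>R \<eta>b"
  have "stationarity_multipliers F f G g xbar ybar zbar ?\<mu> ?\<omega> ?\<eta>"
  proof (rule stationarity_multipliersI)
    have "lag_hessian f g zbar wbar (0, ?\<omega>) = (1 / cb) *\<^sub>R lag_hessian f g zbar wbar (0, \<omega>b)"
      using linear_cmul[OF lin, of "1 / cb" "(0, \<omega>b)"] by simp
    moreover have "(1 / cb) *\<^sub>R (cb *\<^sub>R gradient F wbar + jacobian_T G wbar \<mu>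
        + lag_hessian f g zbar wbar (0, \<omega>b) + jacobian_T g wbar \<eta>b) = 0"
      by (simp only: stat scaleR_zero_right)
    ultimately show "gradient F wbar + jacobian_T G wbar ?\<mu> + lag_hessian f g zbar wbar (0, ?\<omega>)
        + jacobian_T g wbar ?\<eta> = 0"
      using cb by (simp add: jacobian_T_scaleR scaleR_add_right)
    show "0 \<le> ?\<mu>"
      using \<mu> cb by (simp add: less_eq_vec_def)
    show "?\<mu> $ j * G wbar $ j = 0" for j
      using \<mu>_compl[of j] by auto
  qed (use signs in auto)
  \<comment> \<open>Two nonnegative factors are both positive or have product 0, and division by
    \<open>cb\<close> changes no sign.\<close>
  moreover have "?\<eta> $ i > 0 \<and> gradient (\<lambda>y. g (xbar, y) $ i) ybar \<bullet> ?\<omega> > 0 \<or>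
      ?\<eta> $ i * (gradient (\<lambda>y. g (xbar, y) $ i) ybar \<bullet> ?\<omega>) = 0" for i
    using signs[of i] cb
    by (auto simp: gradient_eqI[OF GDERIV_snd[OF GDERIVs(2)[OF in_U(2)]]] less_le)
  ultimately show ?thesis
    unfolding M_stationary_def using feasible by blast
qed

end

theorem theorem4p3:
  fixes F f :: "(real^'n) \<times> (real^'m) \<Rightarrow> real"
    and G :: "(real^'n) \<times> (real^'m) \<Rightarrow> real^'p"
    and g :: "(real^'n) \<times> (real^'m) \<Rightarrow> real^'q"
    and \<gamma>1 \<gamma>2 :: real
    and xbar :: "real^'n" and ybar :: "real^'m" and zbar :: "real^'q"
    and x :: "nat \<Rightarrow> real^'n" and y :: "nat \<Rightarrow> real^'m" and z s :: "nat \<Rightarrow> real^'q"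
    and \<epsilon> :: "nat \<Rightarrow> ((real^'n) \<times> (real^'m)) \<times> ((real^'q) \<times> (real^'q))"
    and \<rho>1 \<rho>2 :: "nat \<Rightarrow> real"
  assumes F_C1: "\<exists>U. open U \<and> Omega G \<subseteq> U \<and> C1_on U F"
    and G_C1_convex: "\<And>j. \<exists>U. open U \<and> Omega G \<subseteq> U \<and>
          C1_on U (\<lambda>w. G w $ j) \<and> convex_on U (\<lambda>w. G w $ j)"
    and f_convex: "\<And>x. x \<in> Xset G \<Longrightarrow> convex_on UNIV (\<lambda>y. f (x, y))"
    and g_convex: "\<And>x i. x \<in> Xset G \<Longrightarrow> convex_on UNIV (\<lambda>y. g (x, y) $ i)"
    and fg_C2: "\<exists>U. open U \<and> Xset G \<times> UNIV \<subseteq> U \<and>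
          C2_on U f \<and> (\<forall>i. C2_on U (\<lambda>w. g w $ i))"
    and gamma_pos: "\<gamma>1 > 0" "\<gamma>2 > 0"
    and rho_pos: "\<And>k. \<rho>1 k > 0" "\<And>k. \<rho>2 k > 0"
    and xy_lim: "(\<lambda>k. (x k, y k)) \<longlonglongrightarrow> (xbar, ybar)"
    and eps_lim: "\<epsilon> \<longlonglongrightarrow> 0"
    and xy_Omega: "\<And>k. (x k, y k) \<in> Omega G"
    and zs_C: "\<And>k. (z k, s k) \<in> Ccompl"
    and gap_lim: "(\<lambda>k. gap f g \<gamma>1 \<gamma>2 (x k) (y k) (z k)) \<longlonglongrightarrow> 0"
    and gs_lim: "(\<lambda>k. g (x k, y k) + s k) \<longlonglongrightarrow> 0"
    and stationary: "\<And>k. \<epsilon> k \<in>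
          (+) ((gradient F (x k, y k), (0, 0))
               + \<rho>1 k *\<^sub>R (fst (gap_gradient f g \<gamma>1 \<gamma>2 (x k) (y k) (z k)),
                          (snd (gap_gradient f g \<gamma>1 \<gamma>2 (x k) (y k) (z k)), 0))
               + \<rho>2 k *\<^sub>R gradient (\<lambda>((x, y), (z, s)). (norm (g (x, y) + s))\<^sup>2)
                            ((x k, y k), (z k, s k)))
          ` (limiting_normal_cone (Omega G) (x k, y k) \<times>
             limiting_normal_cone Ccompl (z k, s k))"
    and MFCQ_lower: "MFCQ_ineq (\<lambda>y. g (xbar, y)) ybar"
    and MFCQ_upper: "MFCQ_ineq G (xbar, ybar)"
    and zbar_nonneg: "0 \<le> zbar"
    and zbar_acc: "\<exists>r. strict_mono r \<and> (z \<circ> r) \<longlonglongrightarrow> zbar"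
  shows "(bounded (range \<rho>1) \<and> bounded (range \<rho>2) \<longrightarrow>
            S_stationary F f G g xbar ybar zbar) \<and>
         (filterlim \<rho>1 at_top sequentially \<and> filterlim \<rho>2 at_top sequentially \<and>
          filterlim (\<lambda>k. \<rho>2 k / \<rho>1 k) at_top sequentially \<and>
          MPCC_MFCQ f G g xbar ybar zbar \<longrightarrow>
            M_stationary F f G g xbar ybar zbar)"
proof -
  obtain r where r: "strict_mono r" "(\<lambda>k. z (r k)) \<longlonglongrightarrow> zbar"
    using zbar_acc by (auto simp: comp_def)
  obtain U where U: "open U" "Xset G \<times> UNIV \<subseteq> U" "C2_on U f" "\<And>i. C2_on U (\<lambda>w. g w $ i)"
    using fg_C2 by blast
  obtain V where V: "open V" "Omega G \<subseteq> V" "C1_on V F"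
    using F_C1 by blast
  have sub: "(\<lambda>k. X (r k)) \<longlonglongrightarrow> L" if "X \<longlonglongrightarrow> L" for X :: "nat \<Rightarrow> 'z::topological_space" and L
    using LIMSEQ_subseq_LIMSEQ[OF that r(1)] by (simp add: comp_def)
  \<comment> \<open>All hypotheses on the sequences are inherited by the subsequence, along which
    the accumulation point is a limit.\<close>
  interpret approximate_stationary_sequence F f G g \<gamma>1 \<gamma>2 xbar ybar zbar
    "\<lambda>k. x (r k)" "\<lambda>k. y (r k)" "\<lambda>k. z (r k)" "\<lambda>k. s (r k)" "\<lambda>k. \<epsilon> (r k)"
    "\<lambda>k. \<rho>1 (r k)" "\<lambda>k. \<rho>2 (r k)" U V
    using V G_C1_convex f_convex g_convex U gamma_pos rho_pos sub[OF xy_lim] r(2) sub[OF eps_lim]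
      xy_Omega zs_C sub[OF gap_lim] sub[OF gs_lim] stationary MFCQ_upper
    by unfold_locales
  show ?thesis
  proof (intro conjI impI; elim conjE)
    assume "bounded (range \<rho>1)" "bounded (range \<rho>2)"
    then show "S_stationary F f G g xbar ybar zbar"
      by (intro S_stationary_if_bounded) (auto elim: bounded_subset)
  next
    assume "filterlim (\<lambda>k. \<rho>2 k / \<rho>1 k) at_top sequentially"
    then have "(\<lambda>k. \<rho>1 k / \<rho>2 k) \<longlonglongrightarrow> 0"
      using tendsto_inverse_0_at_top by fastforce
    moreover assume "MPCC_MFCQ f G g xbar ybar zbar"
    ultimately show "M_stationary F f G g xbar ybar zbar"
      by (intro M_stationary_if_ratio_vanishes sub)
  qed
qed

end
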